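(* Let $d\in\{1,2,3,7,11\}$, $\Sigma_2=\{a,b\}$ and $\Sigma_1=\{c\}$. Then: (1) there is no embedding from $\mathrm{sg}(\Sigma_2)\times\mathrm{fg}(\Sigma_1)$ into $\mathcal{O}_d^{2\times2}$; (2) there is no embedding from $\mathrm{fg}(\Sigma_2)\times\mathrm{fg}(\Sigma_1)$ into $\mathcal{O}_d^{2\times2}$; (3) there is no embedding from $\mathrm{fg}(\Sigma_2)\times\mathrm{sg}(\Sigma_1)$ into $\mathrm{SL}(2,\mathcal{O}_d)$; (4) there is no embedding from $\mathrm{sg}(\Sigma_2)\times\mathrm{sg}(\Sigma_2)$ into $\mathrm{SL}(3,\mathcal{O}_d)$; (5) there is no embedding from $\mathrm{fg}(\Sigma_2)\times\mathrm{sg}(\Sigma_2)$ into $\mathcal{O}_d^{3\times3}$.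
   Context: $\mathcal{O}_d$ is the ring of algebraic integers of the imaginary quadratic field $\mathbb{Q}(\sqrt{-d})$. For an alphabet $\Sigma$, $\mathrm{sg}(\Sigma)$ is the free monoid of finite words over $\Sigma$ (including the empty word $\varepsilon$) under concatenation, and $\mathrm{fg}(\Sigma)$ is the free group on $\Sigma$. Products carry componentwise multiplication. $\mathcal{O}_d^{n\times n}$ is the multiplicative semigroup of $n\times n$ matrices with entries in $\mathcal{O}_d$, and $\mathrm{SL}(n,\mathcal{O}_d)$ the group of such matrices with determinant $1$. An embedding is an injective map $\varphi$ with $\varphi(uv)=\varphi(u)\varphi(v)$ for all $u,v$. *)

theory Defs
  imports "HOL-Analysis.Analysis" "HOL-Computational_Algebra.Polynomial"
begin

section \<open>Rings of integers of imaginary quadratic fields\<close>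

definition algebraic_integer :: "complex \<Rightarrow> bool" where
  "algebraic_integer z \<longleftrightarrow>
     (\<exists>p :: int poly. lead_coeff p = 1 \<and> poly (map_poly of_int p) z = 0)"

text \<open>The field Q(sqrt(-d)) as a subfield of the complex numbers.\<close>
definition quad_field :: "nat \<Rightarrow> complex set" where
  "quad_field d = {of_rat a + of_rat b * (\<i> * of_real (sqrt (real d))) | a b. True}"

text \<open>O_d: the algebraic integers of Q(sqrt(-d)).\<close>
definition O_d :: "nat \<Rightarrow> complex set" where
  "O_d d = {z \<in> quad_field d. algebraic_integer z}"

definition int_mats :: "nat \<Rightarrow> (complex^'n^'n) set" where
  "int_mats d = {A. \<forall>i j. A $ i $ j \<in> O_d d}"

definition SL_mats :: "nat \<Rightarrow> (complex^'n^'n) set" where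
  "SL_mats d = {A \<in> int_mats d. det A = 1}"

section \<open>Alphabets, free monoids, free groups\<close>

datatype sig2 = a | b
datatype sig1 = c

text \<open>Free monoid sg(Sigma): all finite words (lists) under concatenation.\<close>
definition sg_carrier :: "'s list set" where "sg_carrier = UNIV"
definition sg_mult :: "'s list \<Rightarrow> 's list \<Rightarrow> 's list" where "sg_mult u v = u @ v"

text \<open>Free group fg(Sigma): reduced words over letters (True,x) = x and (False,x) = x^-1,
  multiplication is concatenation followed by free reduction.\<close>
fun fg_reduced :: "(bool \<times> 's) list \<Rightarrow> bool" where
  "fg_reduced [] = True"
| "fg_reduced [l] = True"
| "fg_reduced (l # m # w) = (\<not> (snd l = snd m \<and> fst l \<noteq> fst m) \<and> fg_reduced (m # w))"

fun fg_push :: "bool \<times> 's \<Rightarrow> (bool \<times> 's) list \<Rightarrow> (bool \<times> 's) list" where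
  "fg_push l [] = [l]"
| "fg_push l (m # w) = (if snd l = snd m \<and> fst l \<noteq> fst m then w else l # m # w)"

definition fg_reduce :: "(bool \<times> 's) list \<Rightarrow> (bool \<times> 's) list" where
  "fg_reduce w = foldr fg_push w []"

definition fg_carrier :: "(bool \<times> 's) list set" where
  "fg_carrier = {w. fg_reduced w}"

definition fg_mult :: "(bool \<times> 's) list \<Rightarrow> (bool \<times> 's) list \<Rightarrow> (bool \<times> 's) list" where
  "fg_mult u v = fg_reduce (u @ v)"

section \<open>Direct products and embeddings\<close>

definition prod_mult :: "('x \<Rightarrow> 'x \<Rightarrow> 'x) \<Rightarrow> ('y \<Rightarrow> 'y \<Rightarrow> 'y) \<Rightarrow> 'x \<times> 'y \<Rightarrow> 'x \<times> 'y \<Rightarrow> 'x \<times> 'y" where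
  "prod_mult m1 m2 u v = (m1 (fst u) (fst v), m2 (snd u) (snd v))"

text \<open>An embedding of (M, mul) into the semigroup (T, tmul): an injective map M -> T
  with phi(uv) = phi(u) phi(v).\<close>
definition is_embedding ::
  "'m set \<Rightarrow> ('m \<Rightarrow> 'm \<Rightarrow> 'm) \<Rightarrow> 't set \<Rightarrow> ('t \<Rightarrow> 't \<Rightarrow> 't) \<Rightarrow> ('m \<Rightarrow> 't) \<Rightarrow> bool" where
  "is_embedding M mul T tmul \<phi> \<longleftrightarrow>
     inj_on \<phi> M \<and> \<phi> ` M \<subseteq> T \<and> (\<forall>u\<in>M. \<forall>v\<in>M. \<phi> (mul u v) = tmul (\<phi> u) (\<phi> v))"

end

theory Submission
  imports Defs "HOL-Computational_Algebra.Fundamental_Theorem_Algebra"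
begin

text \<open>
  Every image of one factor of the product commutes with the images A, B of two non-commuting
  words of the other factor. A 2 x 2 matrix commuting with A and B is scalar; a 3 x 3 matrix X
  commuting with A and B has no cyclic vector, so it satisfies a quadratic equation and its
  characteristic polynomial is (z - l)^2 (z - m).

  For entries in O_d the eigenvalues are algebraic over the ring generated by the entries, so
  their powers have bounded denominators in Q(sqrt(-d)); if the determinant is a unit, the same
  holds for their inverses, and since a lattice meets the unit disc in finitely many points,
  l and m are roots of unity. Hence X has finite order, which injectivity forbids on a free
  factor, or X = l + N with N^2 = 0 and |l| = 1. For two such matrices A, B for which all
  A^(k+1) B are of the same form, the trace of A^(k+1) B grows linearly in k unless
  tr(N_A N_B) = 0, and then the square-zero condition on AB forces N_A N_B = N_B N_A = 0, so
  A and B commute, again contradicting injectivity.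
\<close>

section \<open>Matrices commuting with a non-commuting pair\<close>

lemma mat_nth: "(mat k :: 'a::zero^'n^'n) $ i $ j = (if i = j then k else 0)"
  by (simp add: mat_def)

lemma mat_mult_mat: "(mat x :: 'a::semiring_1^'n^'n) ** mat y = mat (x * y)"
  by (simp add: vec_eq_iff matrix_matrix_mult_def mat_def mult_delta_left sum.delta)

lemma mat_mult_nth: "(mat k ** (A::'a::semiring_1^'n^'n)) $ i $ j = k * A $ i $ j"
  by (simp add: matrix_matrix_mult_def mat_def mult_delta_left sum.delta)

lemma matrix_mult_mat_nth: "((A::'a::semiring_1^'n^'n) ** mat k) $ i $ j = A $ i $ j * k"
  by (simp add: matrix_matrix_mult_def mat_def mult_delta_right sum.delta')

lemma mat_mult_commute: "mat k ** (A::'a::comm_semiring_1^'n^'n) = A ** mat k"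
  by (simp add: vec_eq_iff mat_mult_nth matrix_mult_mat_nth mult.commute)

lemma matrix_mult_diff_distrib:
  fixes A B C :: "'a::ring_1^'n^'n"
  shows "(A - B) ** C = A ** C - B ** C" "C ** (A - B) = C ** A - C ** B"
  by (simp_all add: vec_eq_iff matrix_matrix_mult_def sum_subtractf algebra_simps)

lemma mat_mult_eq_self_iff:
  assumes "l \<noteq> 0"
  shows "mat l ** (E::'a::field^'n^'n) = mat l \<longleftrightarrow> E = mat 1"
  using assms by (auto simp: vec_eq_iff mat_mult_nth mat_nth)

lemma matrix_mult_2_nth: "((A::'a::semiring_1^2^2) ** B) $ i $ j = A$i$1 * B$1$j + A$i$2 * B$2$j"
  by (simp add: matrix_matrix_mult_def sum_2)

lemma commutant_of_noncommuting_pair_2: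
  fixes X A B :: "'a::idom^2^2"
  assumes XA: "X ** A = A ** X" and XB: "X ** B = B ** X" and AB: "A ** B \<noteq> B ** A"
  shows "\<exists>l. X = mat l"
proof (rule ccontr)
  assume nonscalar: "\<nexists>l. X = mat l"
  define p q r s where "p = X$1$1" "q = X$1$2" "r = X$2$1" "s = X$2$2"
  have "q \<noteq> 0 \<or> r \<noteq> 0 \<or> p - s \<noteq> 0"
  proof (rule ccontr)
    assume "\<not> ?thesis"
    then have "X = mat p" unfolding p_q_r_s_def by (auto simp: vec_eq_iff forall_2 mat_nth)
    with nonscalar show False by blast
  qed
  then obtain e where e: "e \<noteq> 0" "e = q \<or> e = r \<or> e = p - s" by blast
  define a1 a2 a3 a4 where "a1 = A$1$1" "a2 = A$1$2" "a3 = A$2$1" "a4 = A$2$2"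
  define b1 b2 b3 b4 where "b1 = B$1$1" "b2 = B$1$2" "b3 = B$2$1" "b4 = B$2$2"
  have HA: "q * a3 = r * a2" "p * a2 + q * a4 = a1 * q + a2 * s" "r * a1 + s * a3 = a3 * p + a4 * r"
    using XA[THEN arg_cong[where f = "\<lambda>M. M$1$1"]] XA[THEN arg_cong[where f = "\<lambda>M. M$1$2"]]
      XA[THEN arg_cong[where f = "\<lambda>M. M$2$1"]]
    unfolding matrix_mult_2_nth p_q_r_s_def a1_a2_a3_a4_def by (simp_all add: algebra_simps)
  have HB: "q * b3 = r * b2" "p * b2 + q * b4 = b1 * q + b2 * s" "r * b1 + s * b3 = b3 * p + b4 * r"
    using XB[THEN arg_cong[where f = "\<lambda>M. M$1$1"]] XB[THEN arg_cong[where f = "\<lambda>M. M$1$2"]]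
      XB[THEN arg_cong[where f = "\<lambda>M. M$2$1"]]
    unfolding matrix_mult_2_nth p_q_r_s_def b1_b2_b3_b4_def by (simp_all add: algebra_simps)
  \<comment> \<open>the entries of the commutator AB - BA, each annihilated by e * e\<close>
  define c11 c12 c21 where "c11 = a2 * b3 - b2 * a3"
    "c12 = (a1 - a4) * b2 - (b1 - b4) * a2" "c21 = a3 * (b1 - b4) - b3 * (a1 - a4)"
  have "e * e * c11 = 0 \<and> e * e * c12 = 0 \<and> e * e * c21 = 0"
    using e(2) HA HB unfolding c11_c12_c21_def by (elim disjE; intro conjI; algebra)
  then have "c11 = 0" "c12 = 0" "c21 = 0" using e(1) by auto
  then have "A ** B = B ** A"
    unfolding c11_c12_c21_def a1_a2_a3_a4_def b1_b2_b3_b4_def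
    by (simp add: vec_eq_iff forall_2 matrix_mult_2_nth algebra_simps)
  with AB show False by contradiction
qed

lemma matrix_mult_3_nth:
  "((A::'a::semiring_1^3^3) ** B) $ i $ j = A$i$1 * B$1$j + A$i$2 * B$2$j + A$i$3 * B$3$j"
  by (simp add: matrix_matrix_mult_def sum_3)

lemma matrix_vector_mult_3_nth:
  "((A::'a::semiring_1^3^3) *v v) $ i = A$i$1 * v$1 + A$i$2 * v$2 + A$i$3 * v$3"
  by (simp add: matrix_vector_mult_def sum_3)

lemma vector_3_nth:
  "(vector [x, y, z] :: 'a::zero^3) $ 1 = x" "(vector [x, y, z] :: 'a::zero^3) $ 2 = y"
  "(vector [x, y, z] :: 'a::zero^3) $ 3 = z"
  by (simp_all add: vector_def)

definition cols3 :: "'a^3 \<Rightarrow> 'a^3 \<Rightarrow> 'a^3 \<Rightarrow> 'a^3^3" where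
  "cols3 x y z = (\<chi> i j. if j = 1 then x$i else if j = 2 then y$i else z$i)"

lemma matrix_mult_cols3: "Q ** cols3 x y z = cols3 (Q *v x) (Q *v y) (Q *v z)"
  by (auto simp: vec_eq_iff matrix_matrix_mult_def matrix_vector_mult_def cols3_def forall_3)

lemma cols3_mult_vector:
  "cols3 x y z *v (w::'a::comm_semiring_1^3) = (\<chi> i. w$1 * x$i + w$2 * y$i + w$3 * z$i)"
  by (simp add: vec_eq_iff matrix_vector_mult_3_nth cols3_def algebra_simps)

text \<open>The vector v is cyclic for X iff the Krylov matrix is invertible.\<close>
definition krylov3 :: "'a::semiring_1^3^3 \<Rightarrow> 'a^3 \<Rightarrow> 'a^3^3" where
  "krylov3 X v = cols3 v (X *v v) (X *v (X *v v))"

definition quadratic_mat :: "'a::semiring_1^3^3 \<Rightarrow> 'a^3 \<Rightarrow> 'a^3^3" where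
  "quadratic_mat X p = mat (p$1) + mat (p$2) ** X + mat (p$3) ** (X ** X)"

lemma quadratic_mat_mult_vector:
  "quadratic_mat X p *v y = (\<chi> i. p$1 * y$i + p$2 * (X *v y)$i + p$3 * (X *v (X *v y))$i)"
  by (simp add: vec_eq_iff forall_3 matrix_vector_mult_3_nth matrix_mult_3_nth
      mat_nth quadratic_mat_def algebra_simps)

lemma commute_matrix_vector_mult: "X ** W = W ** X \<Longrightarrow> W *v (X *v y) = X *v (W *v y)"
  by (simp add: matrix_vector_mul_assoc)

lemma quadratic_mat_commute:
  fixes X W :: "'a::comm_semiring_1^3^3"
  assumes "X ** W = W ** X"
  shows "W ** quadratic_mat X p = quadratic_mat X p ** W"
proof -
  have "W *v (\<chi> i. x * u$i + y * w$i + z * r$i)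
      = (\<chi> i. x * (W *v u)$i + y * (W *v w)$i + z * (W *v r)$i)"
    for x y z u w r by (simp add: vec_eq_iff forall_3 matrix_vector_mult_3_nth algebra_simps)
  then have "(W ** quadratic_mat X p) *v y = (quadratic_mat X p ** W) *v y" for y
    by (simp add: matrix_vector_mul_assoc[symmetric] quadratic_mat_mult_vector
        commute_matrix_vector_mult[OF assms])
  then show ?thesis by (simp add: matrix_eq)
qed

lemma commutant_of_cyclic_commutative:
  fixes X Y Z :: "'a::field^3^3"
  assumes cyclic: "det (krylov3 X v) \<noteq> 0" and XY: "X ** Y = Y ** X" and XZ: "X ** Z = Z ** X"
  shows "Y ** Z = Z ** Y"
proof -
  define K where "K = krylov3 X v"
  obtain K' where KK': "K ** K' = mat 1"
    using cyclic invertible_det_nz unfolding K_def invertible_def by blast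
  \<comment> \<open>everything commuting with X is a polynomial in X, namely the one that agrees with it on v\<close>
  have polynomial: "W = quadratic_mat X (K' *v (W *v v))" if XW: "X ** W = W ** X" for W
  proof -
    define p where "p = K' *v (W *v v)"
    have "W *v v = K *v p" by (simp add: p_def matrix_vector_mul_assoc matrix_mul_assoc KK')
    also have "\<dots> = quadratic_mat X p *v v"
      by (simp add: K_def krylov3_def cols3_mult_vector quadratic_mat_mult_vector)
    finally have "W ** K = quadratic_mat X p ** K"
      unfolding K_def krylov3_def matrix_mult_cols3
      by (simp add: commute_matrix_vector_mult[OF XW]
          commute_matrix_vector_mult[OF quadratic_mat_commute[OF refl]])
    then have "W ** K ** K' = quadratic_mat X p ** K ** K'" by simp
    then show ?thesis by (simp add: matrix_mul_assoc[symmetric] KK' p_def)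
  qed
  have "Y ** Z = Y ** quadratic_mat X (K' *v (Z *v v))" using polynomial[OF XZ] by simp
  also have "\<dots> = quadratic_mat X (K' *v (Z *v v)) ** Y" by (rule quadratic_mat_commute[OF XY])
  finally show ?thesis using polynomial[OF XZ] by simp
qed

lemma det_krylov3_first_column_zero:
  fixes T :: "'a::comm_ring_1^3^3"
  assumes "T$1$1 = 0" "T$2$1 = 0" "T$3$1 = 0"
  shows "det (krylov3 T (vector [v1, x, 1])) =
    (T$3$2 * x^2 + (T$3$3 - T$2$2) * x - T$2$3) *
    (v1 * (T$2$2 * T$3$3 - T$2$3 * T$3$2)
     + (T$1$3 * T$3$2 - T$1$2 * T$3$3) * x + (T$1$2 * T$2$3 - T$1$3 * T$2$2))"
  using assms
  by (simp add: det_3 krylov3_def cols3_def matrix_vector_mult_3_nth vector_3_nth algebra_simps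
      power2_eq_square)

text \<open>Writing T = [[0, r], [0, T']], the determinant above factors as q(w) * (v1 det T' + l(w))
  with q(w) = det [w, T' w] and l(w) = r (T' - tr T') w. Setting the second coordinate to 1 turns
  both factors into univariate polynomials, and C[x] has no zero divisors.\<close>
lemma square_eq_scalar_multiple_if_no_cyclic_vector:
  fixes T :: "complex^3^3"
  assumes col: "T$1$1 = 0" "T$2$1 = 0" "T$3$1 = 0" and noncyclic: "\<And>v. det (krylov3 T v) = 0"
  shows "\<exists>s. T ** T = mat s ** T"
proof -
  define q where "q = [:- T$2$3, T$3$3 - T$2$2, T$3$2:]"
  define l where "l = [:T$1$2 * T$2$3 - T$1$3 * T$2$2, T$1$3 * T$3$2 - T$1$2 * T$3$3:]"
  define \<delta> where "\<delta> = T$2$2 * T$3$3 - T$2$3 * T$3$2"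
  have "poly (q * (smult v1 [:\<delta>:] + l)) x = 0" for v1 x
    using noncyclic[of "vector [v1, x, 1]"] det_krylov3_first_column_zero[OF col, of v1 x]
    by (simp add: q_def l_def \<delta>_def algebra_simps power2_eq_square)
  then have "q * (smult v1 [:\<delta>:] + l) = 0" for v1
    using poly_all_0_iff_0 by blast
  from this[of 0] this[of 1] have "q = 0 \<or> (l = 0 \<and> \<delta> = 0)"
    by auto
  then show ?thesis
  proof
    assume "q = 0"
    then have "T ** T = mat (T$2$2) ** T"
      using col by (simp add: q_def vec_eq_iff forall_3 matrix_mult_3_nth mat_nth algebra_simps)
    then show ?thesis by blast
  next
    assume "l = 0 \<and> \<delta> = 0"
    then have "T ** T = mat (T$2$2 + T$3$3) ** T"
      using col by (simp add: l_def \<delta>_def vec_eq_iff forall_3 matrix_mult_3_nth mat_nth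
          algebra_simps)
    then show ?thesis by blast
  qed
qed

lemma extend_to_basis3:
  assumes "(x::'a::field^3) \<noteq> 0"
  shows "\<exists>y z. det (cols3 x y z) \<noteq> 0"
proof -
  have "x$1 \<noteq> 0 \<or> x$2 \<noteq> 0 \<or> x$3 \<noteq> 0" using assms by (auto simp: vec_eq_iff forall_3)
  then show ?thesis
  proof (elim disjE)
    assume "x$1 \<noteq> 0"
    then have "det (cols3 x (vector [0, 1, 0]) (vector [0, 0, 1])) \<noteq> 0"
      by (simp add: det_3 cols3_def vector_3_nth)
    then show ?thesis by blast
  next
    assume "x$2 \<noteq> 0"
    then have "det (cols3 x (vector [1, 0, 0]) (vector [0, 0, 1])) \<noteq> 0"
      by (simp add: det_3 cols3_def vector_3_nth)
    then show ?thesis by blast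
  next
    assume "x$3 \<noteq> 0"
    then have "det (cols3 x (vector [1, 0, 0]) (vector [0, 1, 0])) \<noteq> 0"
      by (simp add: det_3 cols3_def vector_3_nth)
    then show ?thesis by blast
  qed
qed

text \<open>A change of basis putting the kernel vector first reduces this to the previous lemma.\<close>
lemma square_eq_scalar_multiple_if_singular_noncyclic:
  fixes T :: "complex^3^3"
  assumes kernel: "T *v x = 0" "x \<noteq> 0" and noncyclic: "\<And>v. det (krylov3 T v) = 0"
  shows "\<exists>s. T ** T = mat s ** T"
proof -
  obtain y z where "det (cols3 x y z) \<noteq> 0" using extend_to_basis3[OF kernel(2)] by blast
  then obtain P Q where P: "P = cols3 x y z" and PQ: "P ** Q = mat 1" and QP: "Q ** P = mat 1"
    using invertible_det_nz unfolding invertible_def by blast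
  define T' where "T' = Q ** T ** P"
  have "P *v vector [1, 0, 0] = x" by (simp add: P cols3_mult_vector vector_3_nth vec_eq_iff)
  then have "T' *v vector [1, 0, 0] = 0"
    unfolding T'_def by (simp add: matrix_vector_mul_assoc[symmetric] kernel(1))
  then have col: "T'$1$1 = 0" "T'$2$1 = 0" "T'$3$1 = 0"
    by (simp_all add: vec_eq_iff forall_3 matrix_vector_mult_3_nth vector_3_nth)
  have "det (krylov3 T' v) = 0" for v
  proof -
    have "P *v (Q *v u) = u" "Q *v (P *v u) = u" for u
      by (simp_all add: matrix_vector_mul_assoc PQ QP)
    then have "krylov3 T' v = Q ** krylov3 T (P *v v)"
      unfolding krylov3_def matrix_mult_cols3 T'_def
      by (simp add: matrix_vector_mul_assoc[symmetric])
    then show ?thesis using noncyclic by (simp add: det_mul)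
  qed
  then obtain s where s: "T' ** T' = mat s ** T'"
    using square_eq_scalar_multiple_if_no_cyclic_vector[OF col] by blast
  have T: "T = P ** T' ** Q" unfolding T'_def
    by (simp add: matrix_mul_assoc PQ) (simp add: matrix_mul_assoc[symmetric] PQ)
  have "T ** T = P ** (T' ** (Q ** P) ** T') ** Q"
    by (subst (1 2) T) (simp add: matrix_mul_assoc)
  also have "\<dots> = P ** (mat s ** T') ** Q" by (simp add: QP s)
  also have "\<dots> = mat s ** T" by (metis T matrix_mul_assoc mat_mult_commute)
  finally show ?thesis by blast
qed

lemma eigenvalue_exists3: "\<exists>z. det ((X::complex^3^3) - mat z) = 0"
proof -
  define p where "p = [: det X,
      X$2$3 * X$3$2 + X$1$2 * X$2$1 + X$1$3 * X$3$1 - X$1$1 * X$2$2 - X$1$1 * X$3$3 - X$2$2 * X$3$3,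
      X$1$1 + X$2$2 + X$3$3, -1 :]"
  have p: "poly p z = det (X - mat z)" for z
    by (simp add: p_def det_3 mat_nth algebra_simps)
  have "\<not> constant (poly p)" by (simp add: p_def constant_degree)
  then show ?thesis using fundamental_theorem_of_algebra p by metis
qed

text \<open>A matrix with a cyclic vector has a commutative commutant, and so has X - z for an
  eigenvalue z; hence X - z is a singular matrix without cyclic vector.\<close>
theorem commutant_of_noncommuting_pair_3:
  fixes X C D :: "complex^3^3"
  assumes XC: "X ** C = C ** X" and XD: "X ** D = D ** X" and CD: "C ** D \<noteq> D ** C"
  shows "\<exists>s t. X ** X = mat s ** X + mat t"
proof -
  obtain z where z: "det (X - mat z) = 0" using eigenvalue_exists3 by blast
  define T where "T = X - mat z"
  have TC: "T ** C = C ** T" and TD: "T ** D = D ** T"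
    using XC XD by (simp_all add: T_def matrix_mult_diff_distrib mat_mult_commute)
  have noncyclic: "det (krylov3 T v) = 0" for v
    using commutant_of_cyclic_commutative[OF _ TC TD] CD by blast
  have "\<not> invertible T" using z invertible_det_nz unfolding T_def by blast
  then obtain x where "T *v x = 0" "x \<noteq> 0"
    using invertible_left_inverse matrix_left_invertible_ker by blast
  then obtain s where "T ** T = mat s ** T"
    using square_eq_scalar_multiple_if_singular_noncyclic noncyclic by blast
  then have "X ** X = mat (s + 2 * z) ** X + mat (- s * z - z * z)"
    unfolding T_def by (simp add: vec_eq_iff forall_3 matrix_mult_3_nth mat_nth algebra_simps)
  then show ?thesis by blast
qed

section \<open>Units of imaginary quadratic integers\<close>

definition isqrt :: "nat \<Rightarrow> complex" where
  "isqrt d = \<i> * of_real (sqrt (real d))"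

lemma isqrt_square: "isqrt d * isqrt d = - of_nat d"
proof -
  have "isqrt d * isqrt d = (\<i> * \<i>) * of_real (sqrt (real d) * sqrt (real d))"
    unfolding isqrt_def by (simp only: of_real_mult mult_ac)
  then show ?thesis by simp
qed

definition Z_isqrt :: "nat \<Rightarrow> complex set" where
  "Z_isqrt d = {of_int m + of_int n * isqrt d | m n. True}"

text \<open>The fractional ideal (1/D) Z[sqrt(-d)].\<close>
definition den_lattice :: "nat \<Rightarrow> int \<Rightarrow> complex set" where
  "den_lattice d D = {z. of_int D * z \<in> Z_isqrt d}"

lemma Z_isqrt_add: "x \<in> Z_isqrt d \<Longrightarrow> y \<in> Z_isqrt d \<Longrightarrow> x + y \<in> Z_isqrt d"
proof -
  assume "x \<in> Z_isqrt d" "y \<in> Z_isqrt d"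
  then obtain m n m' n'
    where "x = of_int m + of_int n * isqrt d" "y = of_int m' + of_int n' * isqrt d"
    unfolding Z_isqrt_def by blast
  then have "x + y = of_int (m + m') + of_int (n + n') * isqrt d" by (simp add: algebra_simps)
  then show ?thesis unfolding Z_isqrt_def by blast
qed

lemma Z_isqrt_uminus: "x \<in> Z_isqrt d \<Longrightarrow> - x \<in> Z_isqrt d"
proof -
  assume "x \<in> Z_isqrt d"
  then obtain m n where "x = of_int m + of_int n * isqrt d" unfolding Z_isqrt_def by blast
  then have "- x = of_int (- m) + of_int (- n) * isqrt d" by simp
  then show ?thesis unfolding Z_isqrt_def by blast
qed

lemma Z_isqrt_mult: "x \<in> Z_isqrt d \<Longrightarrow> y \<in> Z_isqrt d \<Longrightarrow> x * y \<in> Z_isqrt d"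
proof -
  assume "x \<in> Z_isqrt d" "y \<in> Z_isqrt d"
  then obtain m n m' n'
    where "x = of_int m + of_int n * isqrt d" "y = of_int m' + of_int n' * isqrt d"
    unfolding Z_isqrt_def by blast
  then have "x * y = of_int m * of_int m' + of_int n * of_int n' * (isqrt d * isqrt d)
      + (of_int m * of_int n' + of_int n * of_int m') * isqrt d"
    by (simp add: algebra_simps)
  also have "\<dots> = of_int (m * m' - int d * n * n') + of_int (m * n' + n * m') * isqrt d"
    unfolding isqrt_square by (simp add: algebra_simps)
  finally show ?thesis unfolding Z_isqrt_def by blast
qed

lemma of_int_in_Z_isqrt: "of_int k \<in> Z_isqrt d"
  unfolding Z_isqrt_def by (rule CollectI, rule exI[of _ k], rule exI[of _ 0], simp)

lemma den_lattice_add: "x \<in> den_lattice d D \<Longrightarrow> y \<in> den_lattice d D \<Longrightarrow> x + y \<in> den_lattice d D"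
  unfolding den_lattice_def by (simp add: distrib_left Z_isqrt_add)

lemma den_lattice_uminus: "x \<in> den_lattice d D \<Longrightarrow> - x \<in> den_lattice d D"
  unfolding den_lattice_def using Z_isqrt_uminus by fastforce

lemma den_lattice_diff: "x \<in> den_lattice d D \<Longrightarrow> y \<in> den_lattice d D \<Longrightarrow> x - y \<in> den_lattice d D"
  using den_lattice_add[OF _ den_lattice_uminus] by fastforce

lemma of_int_in_den_lattice: "of_int k \<in> den_lattice d 1"
  unfolding den_lattice_def using of_int_in_Z_isqrt by simp

lemma zero_in_den_lattice: "0 \<in> den_lattice d D"
  unfolding den_lattice_def using of_int_in_Z_isqrt[of 0] by simp

lemma den_lattice_mult:
  "x \<in> den_lattice d D1 \<Longrightarrow> y \<in> den_lattice d D2 \<Longrightarrow> x * y \<in> den_lattice d (D1 * D2)"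
  unfolding den_lattice_def using Z_isqrt_mult by (fastforce simp: mult_ac)

lemma den_lattice_mono: "x \<in> den_lattice d D \<Longrightarrow> x \<in> den_lattice d (D * E)"
proof -
  assume "x \<in> den_lattice d D"
  then have "of_int E * (of_int D * x) \<in> Z_isqrt d"
    unfolding den_lattice_def using Z_isqrt_mult of_int_in_Z_isqrt by blast
  then show ?thesis unfolding den_lattice_def by (simp add: mult_ac)
qed

lemma den_lattice_sum:
  "(\<And>i. i \<in> S \<Longrightarrow> f i \<in> den_lattice d D) \<Longrightarrow> sum f S \<in> den_lattice d D"
  by (induction S rule: infinite_finite_induct) (auto simp: zero_in_den_lattice den_lattice_add)

lemma den_lattice_power: "x \<in> den_lattice d D \<Longrightarrow> x ^ k \<in> den_lattice d (D ^ k)"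
  by (induction k) (auto simp: of_int_in_den_lattice[of 1, simplified] intro: den_lattice_mult)

lemma quad_field_den_lattice:
  assumes "z \<in> quad_field d"
  shows "\<exists>D>0. z \<in> den_lattice d D"
proof -
  obtain x y where z: "z = of_rat x + of_rat y * isqrt d"
    using assms unfolding quad_field_def isqrt_def by blast
  obtain p1 q1 where pq1: "quotient_of x = (p1, q1)" by (cases "quotient_of x")
  obtain p2 q2 where pq2: "quotient_of y = (p2, q2)" by (cases "quotient_of y")
  have q: "q1 > 0" "q2 > 0" using quotient_of_denom_pos[OF pq1] quotient_of_denom_pos[OF pq2] .
  have x: "(of_rat x :: complex) = of_int p1 / of_int q1"
    and y: "(of_rat y :: complex) = of_int p2 / of_int q2"
    using quotient_of_div[OF pq1] quotient_of_div[OF pq2] by (simp_all add: of_rat_divide)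
  have "of_int (q1 * q2) * z = of_int (p1 * q2) + of_int (p2 * q1) * isqrt d"
    using q unfolding z x y by (simp add: field_simps)
  then have "z \<in> den_lattice d (q1 * q2)" unfolding den_lattice_def Z_isqrt_def by blast
  then show ?thesis using q by (intro exI[of _ "q1 * q2"]) auto
qed

text \<open>Multiply by the conjugate: (m + n sqrt(-d)) (m - n sqrt(-d)) = m^2 + d n^2.\<close>
lemma den_lattice_inverse:
  assumes "z \<in> den_lattice d D" "D > 0" "z \<noteq> 0"
  shows "\<exists>D'>0. inverse z \<in> den_lattice d D'"
proof -
  obtain m n where mn: "of_int D * z = of_int m + of_int n * isqrt d"
    using assms(1) unfolding den_lattice_def Z_isqrt_def by blast
  have "of_int m + of_int n * isqrt d \<noteq> 0" using mn assms(2,3) by auto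
  then have "m \<noteq> 0 \<or> (d \<noteq> 0 \<and> n \<noteq> 0)" by (auto simp: isqrt_def)
  then have pos: "m^2 + int d * n^2 > 0" by (auto simp: add_pos_nonneg add_nonneg_pos)
  have "(of_int m + of_int n * isqrt d) * (of_int m - of_int n * isqrt d)
      = of_int (m^2 + int d * n^2)"
    by (simp add: algebra_simps isqrt_square power2_eq_square)
  then have "of_int (m^2 + int d * n^2) * inverse z
      = (of_int m + of_int n * isqrt d) * (of_int m - of_int n * isqrt d) * inverse z"
    by simp
  also have "\<dots> = of_int (D * m) + of_int (- D * n) * isqrt d"
    using assms(3) unfolding mn[symmetric] by (simp add: field_simps)
  finally have "inverse z \<in> den_lattice d (m^2 + int d * n^2)"
    unfolding den_lattice_def Z_isqrt_def by blast
  then show ?thesis using pos by blast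
qed

lemma finite_den_lattice_disc:
  assumes "d > 0" "D > 0"
  shows "finite (den_lattice d D \<inter> {z. cmod z \<le> 1})"
proof -
  let ?f = "\<lambda>(m, n). (of_int m + of_int n * isqrt d) / (of_int D :: complex)"
  have "den_lattice d D \<inter> {z. cmod z \<le> 1} \<subseteq> ?f ` ({-D..D} \<times> {-D..D})"
  proof
    fix z assume z: "z \<in> den_lattice d D \<inter> {z. cmod z \<le> 1}"
    then obtain m n where mn: "of_int D * z = of_int m + of_int n * isqrt d"
      unfolding den_lattice_def Z_isqrt_def by blast
    have norm: "cmod (of_int D * z) \<le> of_int D" using z assms by (simp add: norm_mult)
    have m: "\<bar>real_of_int m\<bar> \<le> of_int D"
      using abs_Re_le_cmod[of "of_int D * z"] norm mn by (simp add: isqrt_def)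
    have "\<bar>real_of_int n\<bar> * sqrt (real d) \<le> of_int D"
      using abs_Im_le_cmod[of "of_int D * z"] norm mn by (simp add: isqrt_def abs_mult)
    moreover have "sqrt (real d) \<ge> 1" using assms(1) by simp
    ultimately have n: "\<bar>real_of_int n\<bar> \<le> of_int D"
      by (smt (verit) mult_le_cancel_left1 abs_ge_zero mult.commute)
    have "z = ?f (m, n)" using mn assms by (simp add: field_simps)
    with m n show "z \<in> ?f ` ({-D..D} \<times> {-D..D})" by force
  qed
  then show ?thesis by (rule finite_subset) auto
qed

definition power_bounded :: "nat \<Rightarrow> complex \<Rightarrow> bool" where
  "power_bounded d z \<longleftrightarrow> (\<exists>D>0. \<forall>k. z ^ k \<in> den_lattice d D)"

lemma root_of_unity_if_power_bounded_in_disc: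
  assumes "d > 0" "power_bounded d z" "z \<noteq> 0" "cmod z \<le> 1"
  shows "\<exists>m>0. z ^ m = 1"
proof -
  obtain D where "D > 0" "\<forall>k. z ^ k \<in> den_lattice d D"
    using assms(2) unfolding power_bounded_def by blast
  then have "range (\<lambda>k. z ^ k) \<subseteq> den_lattice d D \<inter> {z. cmod z \<le> 1}"
    using assms(4) by (auto simp: norm_power power_le_one)
  then have "finite (range (\<lambda>k::nat. z ^ k))"
    using finite_den_lattice_disc[OF assms(1) \<open>D > 0\<close>] finite_subset by blast
  then have "\<not> inj (\<lambda>k::nat. z ^ k)" using finite_imageD infinite_UNIV_nat by blast
  then obtain i j where "i < j" "z ^ i = z ^ j" unfolding inj_def by (metis linorder_neqE_nat)
  moreover have "z ^ j = z ^ i * z ^ (j - i)" using \<open>i < j\<close> by (simp flip: power_add)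
  ultimately show ?thesis using assms(3) by (intro exI[of _ "j - i"]) auto
qed

text \<open>In an imaginary quadratic field the only units are roots of unity: both z and its inverse
  have powers with bounded denominators, and one of them lies in the unit disc.\<close>
lemma root_of_unity_if_power_bounded:
  assumes "d > 0" "z \<noteq> 0" "power_bounded d z" "power_bounded d (inverse z)"
  shows "\<exists>m>0. z ^ m = 1"
proof (cases "cmod z \<le> 1")
  case True
  then show ?thesis using root_of_unity_if_power_bounded_in_disc assms by blast
next
  case False
  then have "cmod (inverse z) \<le> 1" by (simp add: norm_inverse inverse_le_1_iff)
  then obtain m where "m > 0" "inverse z ^ m = 1"
    using root_of_unity_if_power_bounded_in_disc assms by (metis inverse_nonzero_iff_nonzero)
  then show ?thesis by (metis inverse_1 power_inverse inverse_inverse_eq)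
qed

text \<open>All powers of a root of a monic polynomial over R are R-combinations of its first n powers,
  so their denominators are bounded by those of R and of z, ..., z^(n-1).\<close>
lemma power_bounded_if_integral:
  fixes z :: complex and R :: "complex set" and p :: "nat \<Rightarrow> complex"
  assumes R: "0 \<in> R" "1 \<in> R" "\<And>x y. x \<in> R \<Longrightarrow> y \<in> R \<Longrightarrow> x + y \<in> R"
      "\<And>x y. x \<in> R \<Longrightarrow> y \<in> R \<Longrightarrow> x * y \<in> R" "R \<subseteq> den_lattice d D0" "D0 > 0"
    and p: "\<And>j. j < n \<Longrightarrow> p j \<in> R" and root: "z ^ n = (\<Sum>j<n. p j * z ^ j)"
    and z: "z \<in> den_lattice d D1" "D1 > 0"
  shows "power_bounded d z"
proof (cases n)
  case 0
  then show ?thesis using root by (auto simp: power_bounded_def)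
next
  case (Suc n')
  have combination: "\<exists>e. (\<forall>j<n. e j \<in> R) \<and> z ^ k = (\<Sum>j<n. e j * z ^ j)" for k
  proof (induction k)
    case 0
    have "z ^ 0 = (\<Sum>j<n. (if j = 0 then 1 else 0) * z ^ j)" using Suc
      by (simp add: mult_delta_left sum.delta)
    then show ?case using R(1,2) by (intro exI[of _ "\<lambda>j. if j = 0 then 1 else 0"]) auto
  next
    case (Suc k)
    then obtain e where e: "\<forall>j<n. e j \<in> R" and zk: "z ^ k = (\<Sum>j<n. e j * z ^ j)" by blast
    define e' where "e' j = (if j = 0 then 0 else e (j - 1)) + e n' * p j" for j
    have "z ^ Suc k = (\<Sum>j<n'. e j * z ^ Suc j) + e n' * z ^ n"
      using \<open>n = Suc n'\<close> by (simp add: zk sum_distrib_left algebra_simps)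
    also have "(\<Sum>j<n'. e j * z ^ Suc j) = (\<Sum>j<n. (if j = 0 then 0 else e (j - 1)) * z ^ j)"
      unfolding \<open>n = Suc n'\<close> by (subst sum.lessThan_Suc_shift) simp
    also have "\<dots> + e n' * z ^ n = (\<Sum>j<n. e' j * z ^ j)"
      unfolding root e'_def by (simp add: algebra_simps sum.distrib sum_distrib_left)
    finally have "z ^ Suc k = (\<Sum>j<n. e' j * z ^ j)" .
    moreover have "e' j \<in> R" if "j < n" for j
      using e p R(1,3,4) that \<open>n = Suc n'\<close> unfolding e'_def by simp
    ultimately show ?case by blast
  qed
  have small_powers: "z ^ j \<in> den_lattice d (D1 ^ n)" if "j < n" for j
    using den_lattice_mono[OF den_lattice_power[OF z(1)], of j "D1 ^ (n - j)"] that
    by (simp flip: power_add)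
  have "z ^ k \<in> den_lattice d (D0 * D1 ^ n)" for k
  proof -
    obtain e where "\<forall>j<n. e j \<in> R" "z ^ k = (\<Sum>j<n. e j * z ^ j)" using combination by blast
    then show ?thesis using R(5) small_powers by (auto intro!: den_lattice_sum den_lattice_mult)
  qed
  moreover have "D0 * D1 ^ n > 0" using R(6) z(2) by simp
  ultimately show ?thesis unfolding power_bounded_def by blast
qed

lemma O_d_power_bounded:
  assumes "z \<in> O_d d"
  shows "power_bounded d z"
proof -
  obtain D where D: "D > 0" "z \<in> den_lattice d D"
    using assms quad_field_den_lattice unfolding O_d_def by blast
  obtain p :: "int poly" where p: "lead_coeff p = 1" "poly (map_poly of_int p) z = 0"
    using assms unfolding O_d_def algebraic_integer_def by blast
  define n where "n = degree p"
  have "0 = (\<Sum>i\<le>n. of_int (coeff p i) * z ^ i)"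
    using p(2) by (simp add: n_def poly_altdef coeff_map_poly degree_map_poly)
  also have "\<dots> = (\<Sum>i<n. of_int (coeff p i) * z ^ i) + z ^ n"
    using p(1) by (simp add: n_def lessThan_Suc_atMost[symmetric])
  finally have "z ^ n = (\<Sum>j<n. - of_int (coeff p j) * z ^ j)"
    by (simp add: sum_negf eq_neg_iff_add_eq_0 add.commute)
  moreover have "\<int> \<subseteq> den_lattice d 1" using of_int_in_den_lattice by (auto elim!: Ints_cases)
  ultimately show ?thesis
    using D by (intro power_bounded_if_integral[of \<int> d 1 n "\<lambda>j. - of_int (coeff p j)"]) auto
qed

inductive_set monomials :: "complex set \<Rightarrow> complex set" for F where
  one_in_monomials: "1 \<in> monomials F"
| mult_in_monomials: "f \<in> F \<Longrightarrow> m \<in> monomials F \<Longrightarrow> f * m \<in> monomials F"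

text \<open>The subring of the complex numbers generated by F, built as the additive group generated
  by the monomials so that it visibly has bounded denominators when F is finite.\<close>
inductive_set ring_gen :: "complex set \<Rightarrow> complex set" for F where
  monomial_in_ring_gen: "m \<in> monomials F \<Longrightarrow> m \<in> ring_gen F"
| zero_in_ring_gen: "0 \<in> ring_gen F"
| add_in_ring_gen: "x \<in> ring_gen F \<Longrightarrow> y \<in> ring_gen F \<Longrightarrow> x + y \<in> ring_gen F"
| uminus_in_ring_gen: "x \<in> ring_gen F \<Longrightarrow> - x \<in> ring_gen F"

lemma monomials_mult: "m1 \<in> monomials F \<Longrightarrow> m2 \<in> monomials F \<Longrightarrow> m1 * m2 \<in> monomials F"
  by (induction m1 rule: monomials.induct) (simp_all add: mult.assoc mult_in_monomials)

lemma ring_gen_mult: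
  assumes "x \<in> ring_gen F" "y \<in> ring_gen F"
  shows "x * y \<in> ring_gen F"
proof -
  have "x * m \<in> ring_gen F" if "m \<in> monomials F" for m
    using assms(1) that
    by (induction x rule: ring_gen.induct)
      (simp_all add: distrib_right monomials_mult ring_gen.intros)
  with assms(2) show ?thesis
    by (induction y rule: ring_gen.induct) (simp_all add: distrib_left ring_gen.intros)
qed

lemma one_in_ring_gen: "1 \<in> ring_gen F"
  by (simp add: monomial_in_ring_gen one_in_monomials)

lemma generator_in_ring_gen: "f \<in> F \<Longrightarrow> f \<in> ring_gen F"
  using monomial_in_ring_gen mult_in_monomials[OF _ one_in_monomials] by fastforce

lemma diff_in_ring_gen: "x \<in> ring_gen F \<Longrightarrow> y \<in> ring_gen F \<Longrightarrow> x - y \<in> ring_gen F"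
  using add_in_ring_gen[OF _ uminus_in_ring_gen] by fastforce

lemma power_in_ring_gen: "x \<in> ring_gen F \<Longrightarrow> x ^ k \<in> ring_gen F"
  by (induction k) (simp_all add: one_in_ring_gen ring_gen_mult)

lemma monomials_den_lattice:
  assumes "finite F" "\<forall>f\<in>F. power_bounded d f"
  shows "\<exists>D>0. monomials F \<subseteq> den_lattice d D"
  using assms
proof (induction F rule: finite_induct)
  case empty
  have "m = 1" if "m \<in> monomials {}" for m using that by (induction m rule: monomials.induct) auto
  then show ?case using of_int_in_den_lattice[of 1 d] by (intro exI[of _ 1]) auto
next
  case (insert f F)
  obtain DF where DF: "DF > 0" "monomials F \<subseteq> den_lattice d DF" using insert by auto
  obtain Df where Df: "Df > 0" "\<forall>k. f ^ k \<in> den_lattice d Df"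
    using insert.prems unfolding power_bounded_def by auto
  have "\<exists>i m'. m' \<in> monomials F \<and> m = f ^ i * m'" if "m \<in> monomials (insert f F)" for m
    using that
  proof (induction m rule: monomials.induct)
    case one_in_monomials
    then show ?case by (intro exI[of _ 0] exI[of _ 1]) (auto intro: monomials.intros)
  next
    case (mult_in_monomials g m)
    then obtain i m' where m': "m' \<in> monomials F" "m = f ^ i * m'" by blast
    show ?case
    proof (cases "g = f")
      case True
      then show ?thesis using m' by (intro exI[of _ "Suc i"] exI[of _ m']) (auto simp: mult_ac)
    next
      case False
      then show ?thesis using m' mult_in_monomials.hyps
        by (intro exI[of _ i] exI[of _ "g * m'"]) (auto simp: mult_ac intro: monomials.intros)
    qed
  qed
  then have "monomials (insert f F) \<subseteq> den_lattice d (Df * DF)"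
    using Df DF by (blast intro: den_lattice_mult)
  then show ?case using Df DF by (intro exI[of _ "Df * DF"]) auto
qed

lemma ring_gen_den_lattice:
  assumes "finite F" "F \<subseteq> O_d d"
  shows "\<exists>D>0. ring_gen F \<subseteq> den_lattice d D"
proof -
  have "\<forall>f\<in>F. power_bounded d f" using assms(2) O_d_power_bounded by blast
  then obtain D where D: "D > 0" "monomials F \<subseteq> den_lattice d D"
    using monomials_den_lattice[OF assms(1)] by blast
  have "x \<in> den_lattice d D" if "x \<in> ring_gen F" for x
    using that
    by (induction x rule: ring_gen.induct)
      (use D in \<open>auto simp: den_lattice_add den_lattice_uminus zero_in_den_lattice\<close>)
  then show ?thesis using D by blast
qed

text \<open>The reversed polynomial shows that the inverse of such a root is again integral.\<close>
lemma root_of_unity_if_cubic_unit_root: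
  assumes "d > 0" and F: "finite F" "F \<subseteq> O_d d"
    and z: "z \<in> den_lattice d Dz" "Dz > 0" "z \<noteq> 0"
    and coeffs: "\<tau> \<in> ring_gen F" "\<sigma> \<in> ring_gen F" "\<delta> \<in> ring_gen F" "\<delta>' \<in> ring_gen F"
      "\<delta> * \<delta>' = 1"
    and root: "z ^ 3 = \<tau> * z ^ 2 - \<sigma> * z + \<delta>"
  shows "\<exists>m>0. z ^ m = 1"
proof -
  obtain D0 where D0: "D0 > 0" "ring_gen F \<subseteq> den_lattice d D0"
    using ring_gen_den_lattice[OF F] by blast
  have cubic: "power_bounded d y" if "y \<in> den_lattice d Dy" "Dy > 0"
    "p0 \<in> ring_gen F" "p1 \<in> ring_gen F" "p2 \<in> ring_gen F" "y ^ 3 = p2 * y ^ 2 + p1 * y + p0"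
    for y Dy p0 p1 p2
  proof (rule power_bounded_if_integral[of "ring_gen F" d D0 3 "\<lambda>j. [p0, p1, p2] ! j"])
    show "y ^ 3 = (\<Sum>j<3. [p0, p1, p2] ! j * y ^ j)"
      using that(6) by (simp add: numeral_3_eq_3 power2_eq_square)
    show "[p0, p1, p2] ! j \<in> ring_gen F" if "j < 3" for j
      using that \<open>p0 \<in> ring_gen F\<close> \<open>p1 \<in> ring_gen F\<close> \<open>p2 \<in> ring_gen F\<close>
      by (auto simp: numeral_3_eq_3 less_Suc_eq)
  qed (use that D0 in
      \<open>simp_all add: zero_in_ring_gen one_in_ring_gen add_in_ring_gen ring_gen_mult\<close>)
  have "z ^ 3 = \<tau> * z ^ 2 + (- \<sigma>) * z + \<delta>" using root by simp
  then have "power_bounded d z"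
    using cubic[OF z(1,2)] coeffs uminus_in_ring_gen by blast
  obtain Dy where Dy: "Dy > 0" "inverse z \<in> den_lattice d Dy"
    using den_lattice_inverse z by blast
  have inverse_root: "inverse z ^ 3 = (\<delta>' * \<sigma>) * inverse z ^ 2 + (- \<delta>' * \<tau>) * inverse z + \<delta>'"
  proof -
    define y where "y = inverse z"
    have zy: "z * y = 1" using z(3) unfolding y_def by simp
    have "\<delta> * y ^ 3 = (z ^ 3 - \<tau> * z ^ 2 + \<sigma> * z) * y ^ 3" using root by simp
    also have "\<dots> = (z * y) ^ 3 - \<tau> * (z * y) ^ 2 * y + \<sigma> * (z * y) * y ^ 2"
      by (simp add: algebra_simps power2_eq_square power3_eq_cube)
    finally have "\<delta>' * (\<delta> * y ^ 3) = \<delta>' * (1 - \<tau> * y + \<sigma> * y ^ 2)" using zy by simp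
    then have "y ^ 3 = \<delta>' * (1 - \<tau> * y + \<sigma> * y ^ 2)"
      using coeffs(5) by (simp add: mult.assoc[symmetric] mult.commute[of \<delta>'])
    then show ?thesis unfolding y_def by (simp add: algebra_simps)
  qed
  have "power_bounded d (inverse z)"
    using cubic[OF Dy(2,1) _ _ _ inverse_root] coeffs ring_gen_mult uminus_in_ring_gen by simp
  with \<open>power_bounded d z\<close> show ?thesis using root_of_unity_if_power_bounded assms(1) z(3) by blast
qed

lemma zero_in_O_d: "0 \<in> O_d d" and one_in_O_d: "1 \<in> O_d d"
proof -
  have "0 \<in> quad_field d" "1 \<in> quad_field d"
    unfolding quad_field_def by (force intro: exI[of _ 0] exI[of _ 1])+
  moreover have "algebraic_integer 0"
    unfolding algebraic_integer_def by (rule exI[of _ "[:0, 1:]"]) (simp add: map_poly_pCons)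
  moreover have "algebraic_integer 1"
    unfolding algebraic_integer_def by (rule exI[of _ "[:-1, 1:]"]) (simp add: map_poly_pCons)
  ultimately show "0 \<in> O_d d" "1 \<in> O_d d" unfolding O_d_def by blast+
qed

lemma O_d_unit_root_of_unity:
  assumes "d > 0" "l \<in> O_d d" "m \<in> O_d d" "l * m = 1"
  shows "\<exists>k>0. l ^ k = 1"
proof -
  have "inverse l = m" using assms(4) by (rule inverse_unique)
  then have "power_bounded d l" "power_bounded d (inverse l)"
    using O_d_power_bounded assms(2,3) by simp_all
  moreover have "l \<noteq> 0" using assms(4) by auto
  ultimately show ?thesis using root_of_unity_if_power_bounded[OF assms(1)] by blast
qed

section \<open>The ring of 3 x 3 complex matrices\<close>

text \<open>3 x 3 complex matrices as a ring under matrix multiplication (on the vector type,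
  multiplication is entrywise).\<close>
typedef cmat3 = "UNIV :: (complex^3^3) set" by simp

instantiation cmat3 :: ring_1
begin
definition "x + y = Abs_cmat3 (Rep_cmat3 x + Rep_cmat3 y)"
definition "x * y = Abs_cmat3 (Rep_cmat3 x ** Rep_cmat3 y)"
definition "0 = Abs_cmat3 0"
definition "1 = Abs_cmat3 (mat 1)"
definition "- x = Abs_cmat3 (- Rep_cmat3 x)"
definition "x - y = Abs_cmat3 (Rep_cmat3 x - Rep_cmat3 y)"
instance
proof
  fix x y z :: cmat3
  have "(A + B) ** C = A ** C + B ** C" for A B C :: "complex^3^3"
    by (simp add: vec_eq_iff matrix_matrix_mult_def sum.distrib algebra_simps)
  then show "(x + y) * z = x * z + y * z"
    by (simp add: times_cmat3_def plus_cmat3_def Abs_cmat3_inverse)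
  show "x * (y + z) = x * y + x * z"
    by (simp add: times_cmat3_def plus_cmat3_def Abs_cmat3_inverse matrix_add_ldistrib)
  have "(0::complex^3^3) \<noteq> mat 1" by (metis mat_nth zero_index zero_neq_one)
  then show "(0::cmat3) \<noteq> 1" by (simp add: zero_cmat3_def one_cmat3_def Abs_cmat3_inject)
qed (simp_all add: times_cmat3_def plus_cmat3_def zero_cmat3_def one_cmat3_def uminus_cmat3_def
    minus_cmat3_def Abs_cmat3_inverse Rep_cmat3_inverse matrix_mul_assoc add_ac)
end

definition entry :: "cmat3 \<Rightarrow> 3 \<Rightarrow> 3 \<Rightarrow> complex" where
  "entry x i j = Rep_cmat3 x $ i $ j"

definition scal :: "complex \<Rightarrow> cmat3" where
  "scal z = Abs_cmat3 (mat z)"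

definition trace3 :: "cmat3 \<Rightarrow> complex" where
  "trace3 x = entry x 1 1 + entry x 2 2 + entry x 3 3"

text \<open>The sum of the principal 2 x 2 minors: det (z - x) = z^3 - tr x z^2 + pminors3 x z - det x.\<close>
definition pminors3 :: "cmat3 \<Rightarrow> complex" where
  "pminors3 x = entry x 1 1 * entry x 2 2 + entry x 1 1 * entry x 3 3 + entry x 2 2 * entry x 3 3
     - entry x 1 2 * entry x 2 1 - entry x 1 3 * entry x 3 1 - entry x 2 3 * entry x 3 2"

definition det3 :: "cmat3 \<Rightarrow> complex" where
  "det3 x = det (Rep_cmat3 x)"

lemma Rep_cmat3_mult: "Rep_cmat3 (x * y) = Rep_cmat3 x ** Rep_cmat3 y"
  by (simp add: times_cmat3_def Abs_cmat3_inverse)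

lemma Abs_cmat3_mult: "Abs_cmat3 M * Abs_cmat3 N = Abs_cmat3 (M ** N)"
  by (simp add: times_cmat3_def Abs_cmat3_inverse)

lemma entry_mult:
  "entry (x * y) i j
    = entry x i 1 * entry y 1 j + entry x i 2 * entry y 2 j + entry x i 3 * entry y 3 j"
  by (simp add: entry_def Rep_cmat3_mult matrix_mult_3_nth)

lemma entry_add: "entry (x + y) i j = entry x i j + entry y i j"
  by (simp add: entry_def plus_cmat3_def Abs_cmat3_inverse)

lemma entry_diff: "entry (x - y) i j = entry x i j - entry y i j"
  by (simp add: entry_def minus_cmat3_def Abs_cmat3_inverse)

lemma entry_uminus: "entry (- x) i j = - entry x i j"
  by (simp add: entry_def uminus_cmat3_def Abs_cmat3_inverse)

lemma entry_zero: "entry 0 i j = 0"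
  by (simp add: entry_def zero_cmat3_def Abs_cmat3_inverse)

lemma entry_one: "entry 1 i j = (if i = j then 1 else 0)"
  by (simp add: entry_def one_cmat3_def Abs_cmat3_inverse mat_nth)

lemma entry_scal: "entry (scal z) i j = (if i = j then z else 0)"
  by (simp add: entry_def scal_def Abs_cmat3_inverse mat_nth)

lemma entry_Abs_cmat3: "entry (Abs_cmat3 M) i j = M $ i $ j"
  by (simp add: entry_def Abs_cmat3_inverse)

lemmas entry_simps = entry_mult entry_add entry_diff entry_uminus entry_zero entry_one entry_scal

lemma cmat3_eq_iff: "x = y \<longleftrightarrow> (\<forall>i j. entry x i j = entry y i j)"
  by (metis entry_def Rep_cmat3_inject vec_eq_iff)

lemma cmat3_eq_iff_entries:
  "x = y \<longleftrightarrow> entry x 1 1 = entry y 1 1 \<and> entry x 1 2 = entry y 1 2 \<and> entry x 1 3 = entry y 1 3 \<and>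
     entry x 2 1 = entry y 2 1 \<and> entry x 2 2 = entry y 2 2 \<and> entry x 2 3 = entry y 2 3 \<and>
     entry x 3 1 = entry y 3 1 \<and> entry x 3 2 = entry y 3 2 \<and> entry x 3 3 = entry y 3 3"
  unfolding cmat3_eq_iff forall_3 by blast

lemma scal_add: "scal (p + q) = scal p + scal q"
  by (simp add: cmat3_eq_iff entry_simps)

lemma scal_mult: "scal (p * q) = scal p * scal q"
  by (simp add: cmat3_eq_iff_entries entry_simps)

lemma scal_one: "scal 1 = 1"
  by (simp add: cmat3_eq_iff entry_simps)

lemma scal_zero: "scal 0 = 0"
  by (simp add: cmat3_eq_iff entry_simps)

lemma scal_uminus: "scal (- p) = - scal p"
  by (simp add: cmat3_eq_iff entry_simps)

lemma scal_commute: "x * scal p = scal p * x"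
  by (simp add: cmat3_eq_iff_entries entry_simps mult.commute)

lemma scal_power: "scal p ^ k = scal (p ^ k)"
  by (induction k) (simp_all add: scal_one scal_mult)

lemma entry_scal_mult: "entry (scal p * x) i j = p * entry x i j"
  using exhaust_3[of i] by (auto simp: entry_simps)

lemma trace3_add: "trace3 (x + y) = trace3 x + trace3 y"
  by (simp add: trace3_def entry_simps)

lemma trace3_zero: "trace3 0 = 0"
  by (simp add: trace3_def entry_simps)

lemma trace3_scal: "trace3 (scal p) = 3 * p"
  by (simp add: trace3_def entry_simps)

lemma trace3_scal_mult: "trace3 (scal p * x) = p * trace3 x"
  by (simp add: trace3_def entry_scal_mult algebra_simps)

lemma trace3_commute: "trace3 (x * y) = trace3 (y * x)"
  by (simp add: trace3_def entry_simps algebra_simps)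

lemma det3_mult: "det3 (x * y) = det3 x * det3 y"
  by (simp add: det3_def Rep_cmat3_mult det_mul)

lemma det3_entries: "det3 x =
    entry x 1 1 * entry x 2 2 * entry x 3 3 + entry x 1 2 * entry x 2 3 * entry x 3 1
  + entry x 1 3 * entry x 2 1 * entry x 3 2 - entry x 1 1 * entry x 2 3 * entry x 3 2
  - entry x 1 2 * entry x 2 1 * entry x 3 3 - entry x 1 3 * entry x 2 2 * entry x 3 1"
  by (simp add: det3_def det_3 entry_def)

lemma det3_scal: "det3 (scal p) = p ^ 3"
  by (simp add: det3_entries entry_simps power3_eq_cube)

lemma cayley_hamilton3:
  "x * x * x = scal (trace3 x) * (x * x) - scal (pminors3 x) * x + scal (det3 x)"
  by (simp add: cmat3_eq_iff_entries entry_simps trace3_def pminors3_def det3_entries algebra_simps)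

lemma trace3_square: "trace3 (x * x) = trace3 x ^ 2 - 2 * pminors3 x"
  by (simp add: trace3_def pminors3_def entry_simps algebra_simps power2_eq_square)

lemma mult_scal_mult: "x * (scal p * y) = scal p * (x * y)"
  by (metis mult.assoc scal_commute)

lemma scal_mult_scal_mult: "scal p * (scal q * y) = scal (p * q) * y"
  by (simp add: mult.assoc[symmetric] scal_mult)

lemma square_zero_trace:
  assumes "x * x = 0"
  shows "trace3 x = 0" "pminors3 x = 0"
proof -
  have "det3 x * det3 x = 0" using det3_mult[of x x] assms by (simp add: det3_entries entry_simps)
  then have "scal (pminors3 x) * x = 0"
    using cayley_hamilton3[of x] assms by (simp add: scal_zero)
  then have entries: "pminors3 x * entry x i j = 0" for i j
    by (metis entry_scal_mult entry_zero)
  show "pminors3 x = 0"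
  proof (cases "x = 0")
    case True
    then show ?thesis by (simp add: pminors3_def entry_zero)
  next
    case False
    then obtain i j where "entry x i j \<noteq> 0" by (auto simp: cmat3_eq_iff entry_zero)
    then show ?thesis using entries[of i j] by simp
  qed
  then show "trace3 x = 0" using trace3_square[of x] assms by (simp add: trace3_zero)
qed

text \<open>A square-zero 3 x 3 matrix has rank at most one.\<close>
lemma square_zero_minors:
  assumes "x * x = 0"
  shows "entry x i k * entry x l j = entry x l k * entry x i j"
proof -
  have e: "entry (x * x) i j = 0" for i j using assms by (simp add: entry_zero)
  have "entry x 1 1 + entry x 2 2 + entry x 3 3 = 0"
    "entry x 1 1 * entry x 2 2 + entry x 1 1 * entry x 3 3 + entry x 2 2 * entry x 3 3
       - entry x 1 2 * entry x 2 1 - entry x 1 3 * entry x 3 1 - entry x 2 3 * entry x 3 2 = 0"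
    using square_zero_trace[OF assms] by (simp_all add: trace3_def pminors3_def)
  then have "entry x 1 1 * entry x 2 2 = entry x 1 2 * entry x 2 1"
    "entry x 1 1 * entry x 3 3 = entry x 1 3 * entry x 3 1"
    "entry x 2 2 * entry x 3 3 = entry x 2 3 * entry x 3 2"
    "entry x 1 1 * entry x 2 3 = entry x 1 3 * entry x 2 1"
    "entry x 1 1 * entry x 3 2 = entry x 1 2 * entry x 3 1"
    "entry x 2 2 * entry x 1 3 = entry x 2 3 * entry x 1 2"
    "entry x 2 2 * entry x 3 1 = entry x 2 1 * entry x 3 2"
    "entry x 3 3 * entry x 1 2 = entry x 3 2 * entry x 1 3"
    "entry x 3 3 * entry x 2 1 = entry x 3 1 * entry x 2 3"
    using e[of 1 1] e[of 2 2] e[of 3 3] e[of 1 2] e[of 1 3] e[of 2 1] e[of 2 3] e[of 3 1] e[of 3 2]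
    unfolding entry_mult by algebra+
  then have "\<forall>i k l j. entry x i k * entry x l j = entry x l k * entry x i j"
    unfolding forall_3 by (auto simp: ac_simps)
  then show ?thesis by blast
qed

lemma square_zero_sandwich:
  assumes "x * x = 0"
  shows "x * y * x = scal (trace3 (x * y)) * x"
proof -
  have "entry (x * y * x) i j = entry (scal (trace3 (x * y)) * x) i j" for i j
  proof -
    have "entry (x * y * x) i j = (\<Sum>k\<in>UNIV. \<Sum>l\<in>UNIV. entry x i k * entry y k l * entry x l j)"
      by (simp add: entry_mult sum_3 algebra_simps)
    also have "\<dots> = (\<Sum>k\<in>UNIV. \<Sum>l\<in>UNIV. entry x l k * entry y k l * entry x i j)"
      by (intro sum.cong refl) (metis mult.commute mult.left_commute square_zero_minors[OF assms])
    also have "\<dots> = trace3 (x * y) * entry x i j"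
      unfolding trace3_def entry_mult sum_3 by (simp add: algebra_simps)
    also have "\<dots> = entry (scal (trace3 (x * y)) * x) i j" by (simp only: entry_scal_mult)
    finally show ?thesis .
  qed
  then show ?thesis by (simp add: cmat3_eq_iff)
qed

lemma commutant_of_noncommuting_pair:
  assumes "X * C = C * X" "X * D = D * X" "C * D \<noteq> D * C"
  shows "\<exists>s t. X * X = scal s * X + scal t"
proof -
  obtain s t where st: "Rep_cmat3 X ** Rep_cmat3 X = mat s ** Rep_cmat3 X + mat t"
    using commutant_of_noncommuting_pair_3[of "Rep_cmat3 X" "Rep_cmat3 C" "Rep_cmat3 D"] assms
    by (metis Rep_cmat3_mult Rep_cmat3_inject)
  have "entry (X * X) i j = s * entry X i j + (if i = j then t else 0)" for i j
    using st[THEN arg_cong[where f = "\<lambda>M. M $ i $ j"]]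
    by (simp add: entry_def Rep_cmat3_mult mat_mult_nth mat_nth)
  then have "entry (X * X) i j = entry (scal s * X + scal t) i j" for i j
    by (simp add: entry_add entry_scal_mult entry_scal)
  then show ?thesis by (auto simp: cmat3_eq_iff)
qed


lemma affine_eq_affine_iff:
  assumes nonscalar: "\<forall>k. X \<noteq> scal k"
  shows "scal p1 * X + scal q1 = scal p2 * X + scal q2 \<longleftrightarrow> p1 = p2 \<and> q1 = q2"
proof
  assume eq: "scal p1 * X + scal q1 = scal p2 * X + scal q2"
  have e: "(p1 - p2) * entry X i j = (if i = j then q2 - q1 else 0)" for i j
    using eq[THEN arg_cong[where f = "\<lambda>M. entry M i j"]]
    by (cases "i = j") (simp_all add: entry_add entry_scal_mult entry_scal algebra_simps)
  have "p1 = p2"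
  proof (rule ccontr)
    assume "p1 \<noteq> p2"
    then have "entry X i j = entry (scal ((q2 - q1) / (p1 - p2))) i j" for i j
      using e[of i j] by (cases "i = j") (simp_all add: entry_scal field_simps)
    then have "X = scal ((q2 - q1) / (p1 - p2))" by (simp add: cmat3_eq_iff)
    with nonscalar show False by blast
  qed
  then show "p1 = p2 \<and> q1 = q2" using e[of 1 1] by simp
qed simp

lemma affine_mult:
  assumes "X * X = scal s * X + scal t"
  shows "(scal p1 * X + scal q1) * (scal p2 * X + scal q2)
    = scal (p1 * p2 * s + p1 * q2 + q1 * p2) * X + scal (p1 * p2 * t + q1 * q2)"
proof -
  have "(scal p1 * X + scal q1) * (scal p2 * X + scal q2)
      = scal (p1 * p2) * (X * X) + scal (p1 * q2 + q1 * p2) * X + scal (q1 * q2)"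
    by (simp add: cmat3_eq_iff_entries entry_simps algebra_simps)
  also have "\<dots> = scal (p1 * p2 * s + p1 * q2 + q1 * p2) * X + scal (p1 * p2 * t + q1 * q2)"
    unfolding assms by (simp add: cmat3_eq_iff_entries entry_simps algebra_simps)
  finally show ?thesis .
qed

text \<open>For a non-scalar X with X^2 = s X + t, comparing X^3 with the Cayley-Hamilton identity
  shows that the characteristic polynomial is (z - l)^2 (z - m) where l + m = s.\<close>
lemma quadratic_char_poly:
  assumes XX: "X * X = scal s * X + scal t" and nonscalar: "\<forall>k. X \<noteq> scal k"
  defines "l \<equiv> trace3 X - s" and "m \<equiv> 2 * s - trace3 X"
  shows "s = l + m" "t = - (l * m)" "trace3 X = 2 * l + m" "pminors3 X = l\<^sup>2 + 2 * l * m"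
    "det3 X = l\<^sup>2 * m"
proof -
  have "X * X * X = (scal s * X + scal t) * (scal 1 * X + scal 0)" using XX
    by (simp add: scal_one scal_zero)
  also have "\<dots> = scal (s * s + t) * X + scal (s * t)" by (simp add: affine_mult[OF XX])
  moreover have "X * X * X = scal (trace3 X) * (scal s * X + scal t) - scal (pminors3 X) * X
      + scal (det3 X)"
    using cayley_hamilton3[of X] unfolding XX .
  moreover have "\<dots> = scal (trace3 X * s - pminors3 X) * X + scal (trace3 X * t + det3 X)"
    by (simp add: cmat3_eq_iff_entries entry_simps algebra_simps)
  ultimately have "scal (s * s + t) * X + scal (s * t)
      = scal (trace3 X * s - pminors3 X) * X + scal (trace3 X * t + det3 X)"
    by simp
  then have E1: "s * s + t = trace3 X * s - pminors3 X" and E2: "s * t = trace3 X * t + det3 X"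
    using affine_eq_affine_iff[OF nonscalar] by blast+
  have "s * trace3 X + 3 * t = trace3 X ^ 2 - 2 * pminors3 X"
    using trace3_square[of X] unfolding XX by (simp add: trace3_add trace3_scal_mult trace3_scal)
  then have t: "t = 2 * s * s - 3 * s * trace3 X + trace3 X * trace3 X"
    using E1 by (simp add: power2_eq_square) algebra
  show "s = l + m" "trace3 X = 2 * l + m" unfolding l_def m_def by simp_all
  show "t = - (l * m)" using t unfolding l_def m_def by (simp add: algebra_simps)
  show "pminors3 X = l\<^sup>2 + 2 * l * m"
    using E1 t unfolding l_def m_def by (simp add: power2_eq_square) algebra
  show "det3 X = l\<^sup>2 * m"
    using E2 t unfolding l_def m_def by (simp add: power2_eq_square) algebra
qed

lemma power_if_distinct_roots:
  assumes XX: "X * X = scal (l + m) * X + scal (- (l * m))" and "l \<noteq> m"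
  shows "X ^ k = scal ((l ^ k - m ^ k) / (l - m)) * X + scal ((l * m ^ k - m * l ^ k) / (l - m))"
proof (induction k)
  case 0
  then show ?case using \<open>l \<noteq> m\<close> by (simp add: scal_zero scal_one)
next
  case (Suc k)
  have "(l ^ k - m ^ k) * (l + m) + (l * m ^ k - m * l ^ k) = l ^ Suc k - m ^ Suc k"
    "(l ^ k - m ^ k) * - (l * m) = l * m ^ Suc k - m * l ^ Suc k"
    by (simp_all add: algebra_simps)
  then have "(l ^ k - m ^ k) / (l - m) * (l + m) + (l * m ^ k - m * l ^ k) / (l - m)
      = (l ^ Suc k - m ^ Suc k) / (l - m)"
    "(l ^ k - m ^ k) / (l - m) * - (l * m) = (l * m ^ Suc k - m * l ^ Suc k) / (l - m)"
    by (simp_all only: times_divide_eq_left add_divide_distrib[symmetric])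
  moreover have "X ^ Suc k = (scal 1 * X + scal 0) * X ^ k" by (simp add: scal_one scal_zero)
  ultimately show ?case unfolding Suc affine_mult[OF XX] by simp
qed

definition unimodular_unipotent :: "cmat3 \<Rightarrow> bool" where
  "unimodular_unipotent X \<longleftrightarrow> (\<exists>l N. X = scal l + N \<and> N * N = 0 \<and> cmod l = 1)"

lemma torsion_or_unimodular_unipotent_if_roots_of_unity:
  assumes XX: "X * X = scal (l + m) * X + scal (- (l * m))"
    and roots: "kl > 0" "l ^ kl = 1" "km > 0" "m ^ km = 1"
  shows "(\<exists>k>0. X ^ k = 1) \<or> unimodular_unipotent X"
proof (cases "l = m")
  case True
  define N where "N = X - scal l"
  have "N * N = (scal 1 * X + scal (- l)) * (scal 1 * X + scal (- l))"
    by (simp add: N_def scal_one scal_uminus)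
  also have "\<dots> = 0" using True by (simp add: affine_mult[OF XX] scal_zero)
  finally have "N * N = 0" .
  moreover have "cmod l ^ kl = 1 ^ kl" using roots(2) by (simp flip: norm_power)
  then have "cmod l = 1" using power_eq_iff_eq_base[of kl "cmod l" 1] roots(1) by simp
  moreover have "X = scal l + N" by (simp add: N_def)
  ultimately show ?thesis unfolding unimodular_unipotent_def by blast
next
  case False
  have "l ^ (kl * km) = 1" by (simp add: power_mult roots(2))
  moreover have "m ^ (kl * km) = 1" by (simp add: mult.commute[of kl] power_mult roots(4))
  ultimately have "X ^ (kl * km) = 1"
    using False by (simp add: power_if_distinct_roots[OF XX False] scal_zero scal_one)
  moreover have "kl * km > 0" using roots by simp
  ultimately show ?thesis by blast
qed

lemma nonscalar_entry:
  assumes "\<forall>k. X \<noteq> scal k"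
  shows "(\<exists>i j. i \<noteq> j \<and> entry X i j \<noteq> 0) \<or> (\<exists>i j. entry X i i \<noteq> entry X j j)"
proof (rule ccontr)
  assume contra: "\<not> ?thesis"
  have off: "entry X i j = 0" if "i \<noteq> j" for i j using contra that by blast
  have diag: "entry X i i = entry X 1 1" for i using contra by blast
  have "entry X i j = entry (scal (entry X 1 1)) i j" for i j
    using off[of i j] diag[of i] by (cases "i = j") (simp_all add: entry_scal)
  then have "X = scal (entry X 1 1)" unfolding cmat3_eq_iff by blast
  with assms[THEN spec, of "entry X 1 1"] show False by contradiction
qed

lemma den_lattice_divide:
  assumes "x \<in> den_lattice d D" "y \<in> den_lattice d D" "D > 0" "y \<noteq> 0"
  shows "\<exists>D'>0. x / y \<in> den_lattice d D'"
proof -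
  obtain D' where "D' > 0" "inverse y \<in> den_lattice d D'"
    using den_lattice_inverse assms(2-4) by blast
  moreover have "x / y \<in> den_lattice d (D * D')"
    unfolding divide_inverse by (rule den_lattice_mult[OF assms(1)]) fact
  ultimately show ?thesis using assms(3) by (intro exI[of _ "D * D'"]) simp
qed

lemma quadratic_coeff_den_lattice:
  assumes XX: "X * X = scal s * X + scal t" and nonscalar: "\<forall>k. X \<noteq> scal k"
    and entries: "\<And>i j. entry X i j \<in> den_lattice d D" "\<And>i j. entry (X * X) i j \<in> den_lattice d D"
    and "D > 0"
  shows "\<exists>D'>0. s \<in> den_lattice d D'"
proof -
  have XX_entry: "entry (X * X) i j = s * entry X i j + (if i = j then t else 0)" for i j
    unfolding XX by (simp add: entry_add entry_scal_mult entry_scal)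
  from nonscalar_entry[OF nonscalar] show ?thesis
  proof (elim disjE exE conjE)
    fix i j assume "i \<noteq> j" "entry X i j \<noteq> 0"
    then have "s = entry (X * X) i j / entry X i j" by (simp add: XX_entry)
    then show ?thesis
      using den_lattice_divide[OF entries(2) entries(1) \<open>D > 0\<close> \<open>entry X i j \<noteq> 0\<close>] by simp
  next
    fix i j assume "entry X i i \<noteq> entry X j j"
    then have "s = (entry (X * X) i i - entry (X * X) j j) / (entry X i i - entry X j j)"
      by (simp add: XX_entry field_simps)
    then show ?thesis
      using den_lattice_divide[OF den_lattice_diff[OF entries(2) entries(2)]
          den_lattice_diff[OF entries(1) entries(1)] \<open>D > 0\<close>] \<open>entry X i i \<noteq> entry X j j\<close>
      by simp
  qed
qed

lemma ring_gen_matrix_invariants: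
  assumes "\<And>i j. entry X i j \<in> ring_gen F"
  shows "entry (X * X) i j \<in> ring_gen F" "trace3 X \<in> ring_gen F" "pminors3 X \<in> ring_gen F"
    "det3 X \<in> ring_gen F"
  unfolding entry_mult trace3_def pminors3_def det3_entries
  by (intro add_in_ring_gen diff_in_ring_gen ring_gen_mult assms)+

lemma ring_gen_power_bounded:
  assumes "finite F" "F \<subseteq> O_d d" "z \<in> ring_gen F"
  shows "power_bounded d z"
  using ring_gen_den_lattice[OF assms(1,2)] power_in_ring_gen[OF assms(3)]
  unfolding power_bounded_def by blast

lemma root_of_unity_if_unit_in_ring_gen:
  assumes "d > 0" "finite F" "F \<subseteq> O_d d" "z \<in> ring_gen F" "w \<in> ring_gen F" "z * w = 1"
  shows "\<exists>m>0. z ^ m = 1"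
proof -
  have "z \<noteq> 0" "inverse z = w" using assms(6) by (auto intro: inverse_unique)
  moreover have "power_bounded d z" "power_bounded d w"
    using ring_gen_power_bounded assms(2-5) by blast+
  ultimately show ?thesis using root_of_unity_if_power_bounded[OF assms(1)] by auto
qed

text \<open>The eigenvalues of X are roots of its characteristic polynomial, whose coefficients lie in the
  ring generated by the entries and whose constant term is a unit there; so they are roots
  of unity.\<close>
lemma torsion_or_unimodular_unipotent_if_quadratic:
  assumes "d > 0" and F: "finite F" "F \<subseteq> O_d d" and XF: "\<And>i j. entry X i j \<in> ring_gen F"
    and det: "\<delta>' \<in> ring_gen F" "det3 X * \<delta>' = 1"
    and XX: "X * X = scal s * X + scal t" and nonscalar: "\<forall>k. X \<noteq> scal k"
  shows "(\<exists>k>0. X ^ k = 1) \<or> unimodular_unipotent X"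
proof -
  note invariants = ring_gen_matrix_invariants[OF XF]
  obtain D0 where D0: "D0 > 0" "ring_gen F \<subseteq> den_lattice d D0"
    using ring_gen_den_lattice[OF F] by blast
  obtain Ds where Ds: "Ds > 0" "s \<in> den_lattice d Ds"
    using quadratic_coeff_den_lattice[OF XX nonscalar] D0 XF invariants by blast
  define l m where "l = trace3 X - s" "m = 2 * s - trace3 X"
  note char_poly = quadratic_char_poly[OF XX nonscalar, folded l_m_def]
  have trace: "trace3 X \<in> den_lattice d (D0 * Ds)"
    using D0 invariants den_lattice_mono by blast
  have s: "s \<in> den_lattice d (D0 * Ds)"
    using den_lattice_mono[OF Ds(2), of D0] by (simp add: mult.commute)
  have "l \<in> den_lattice d (D0 * Ds)" "m \<in> den_lattice d (D0 * Ds)"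
    using den_lattice_diff[OF trace s] den_lattice_diff[OF den_lattice_add[OF s s] trace]
    by (simp_all only: l_m_def mult_2)
  moreover have "l \<noteq> 0" "m \<noteq> 0" using char_poly(5) det by auto
  moreover have "z ^ 3 = trace3 X * z ^ 2 - pminors3 X * z + det3 X" if "z = l \<or> z = m" for z
    using that unfolding char_poly(3-5)
    by (auto simp: power2_eq_square power3_eq_cube algebra_simps)
  moreover have "D0 * Ds > 0" using D0 Ds by simp
  ultimately have "\<exists>k>0. z ^ k = 1" if "z = l \<or> z = m" for z
    using that root_of_unity_if_cubic_unit_root[OF \<open>d > 0\<close> F _ _ _ invariants(2-4) det] by blast
  then obtain kl km where "kl > 0" "l ^ kl = 1" "km > 0" "m ^ km = 1" by blast
  moreover have "X * X = scal (l + m) * X + scal (- (l * m))"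
    using XX char_poly(1,2) by simp
  ultimately show ?thesis using torsion_or_unimodular_unipotent_if_roots_of_unity by blast
qed

theorem torsion_or_unimodular_unipotent:
  assumes "d > 0"
    and X: "\<And>i j. entry X i j \<in> O_d d" and Y: "\<And>i j. entry Y i j \<in> O_d d"
    and det: "det3 X * det3 Y = 1"
    and commute: "X * C = C * X" "X * D = D * X" "C * D \<noteq> D * C"
  shows "(\<exists>k>0. X ^ k = 1) \<or> unimodular_unipotent X"
proof -
  define F where "F = range (\<lambda>(i, j). entry X i j) \<union> range (\<lambda>(i, j). entry Y i j)"
  have F: "finite F" "F \<subseteq> O_d d" using X Y by (auto simp: F_def)
  have XF: "entry X i j \<in> ring_gen F" for i j by (rule generator_in_ring_gen) (auto simp: F_def)
  have YF: "det3 Y \<in> ring_gen F"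
    by (rule ring_gen_matrix_invariants) (auto intro: generator_in_ring_gen simp: F_def)
  show ?thesis
  proof (cases "\<exists>z. X = scal z")
    case True
    then obtain z where z: "X = scal z" by blast
    have "z \<in> ring_gen F" using XF[of 1 1] by (simp add: z entry_scal)
    moreover have "z * (z ^ 2 * det3 Y) = 1"
      using det by (simp add: z det3_scal power2_eq_square power3_eq_cube mult.assoc)
    ultimately have "\<exists>m>0. z ^ m = 1"
      using root_of_unity_if_unit_in_ring_gen[OF \<open>d > 0\<close> F] YF
      by (meson power_in_ring_gen ring_gen_mult)
    then show ?thesis by (auto simp: z scal_power scal_one)
  next
    case False
    then have "\<forall>k. X \<noteq> scal k" by blast
    moreover obtain s t where "X * X = scal s * X + scal t"
      using commutant_of_noncommuting_pair[OF commute] by blast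
    ultimately show ?thesis
      using torsion_or_unimodular_unipotent_if_quadratic[OF \<open>d > 0\<close> F XF YF det] by blast
  qed
qed


lemma scal_plus_mult:
  "(scal p + scal q * N) * (scal r + scal u * M)
    = scal (p * r) + scal (p * u) * M + scal (q * r) * N + scal (q * u) * (N * M)"
  by (simp add: cmat3_eq_iff_entries entry_simps algebra_simps)

lemma unipotent_power:
  assumes "N * N = 0"
  shows "(scal \<alpha> + N) ^ Suc k = scal (\<alpha> ^ Suc k) + scal (of_nat (Suc k) * \<alpha> ^ k) * N"
proof (induction k)
  case 0
  then show ?case by (simp add: scal_one)
next
  case (Suc k)
  have "(scal \<alpha> + N) ^ Suc (Suc k)
      = (scal \<alpha> + scal 1 * N) * (scal (\<alpha> ^ Suc k) + scal (of_nat (Suc k) * \<alpha> ^ k) * N)"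
    using Suc by (simp add: scal_one)
  also have "\<dots> = scal (\<alpha> ^ Suc (Suc k)) + scal (\<alpha> * (of_nat (Suc k) * \<alpha> ^ k) + \<alpha> ^ Suc k) * N"
    unfolding scal_plus_mult assms by (simp add: scal_add distrib_right add.assoc)
  also have "\<alpha> * (of_nat (Suc k) * \<alpha> ^ k) + \<alpha> ^ Suc k = of_nat (Suc (Suc k)) * \<alpha> ^ Suc k"
    by (simp add: algebra_simps)
  finally show ?case .
qed

lemma trace3_unipotent_power_mult:
  assumes "N1 * N1 = 0" "N2 * N2 = 0"
  shows "trace3 ((scal \<alpha> + N1) ^ Suc k * (scal \<beta> + N2))
    = 3 * \<alpha> ^ Suc k * \<beta> + of_nat (Suc k) * \<alpha> ^ k * trace3 (N1 * N2)"
proof -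
  have "(scal \<alpha> + N1) ^ Suc k * (scal \<beta> + scal 1 * N2)
      = scal (\<alpha> ^ Suc k * \<beta>) + scal (\<alpha> ^ Suc k * 1) * N2
      + scal (of_nat (Suc k) * \<alpha> ^ k * \<beta>) * N1 + scal (of_nat (Suc k) * \<alpha> ^ k * 1) * (N1 * N2)"
    unfolding unipotent_power[OF assms(1)] by (rule scal_plus_mult)
  then show ?thesis
    using square_zero_trace(1)[OF assms(1)] square_zero_trace(1)[OF assms(2)]
    by (simp add: scal_one trace3_add trace3_scal trace3_scal_mult)
qed

lemma zero_if_linearly_bounded:
  fixes T :: complex
  assumes "\<And>k. real (Suc k) * cmod T \<le> C"
  shows "T = 0"
proof (rule ccontr)
  assume "T \<noteq> 0"
  then obtain n :: nat where "C < real n * cmod T" using reals_Archimedean3[of "cmod T"] by auto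
  moreover have "real n * cmod T \<le> real (Suc n) * cmod T" by (simp add: mult_right_mono)
  ultimately show False using assms[of n] by linarith
qed

lemma square_of_sum_square_zero:
  assumes X: "X * X = 0" and Y: "Y * Y = 0" and XYX: "X * Y * X = 0" and YXY: "Y * X * Y = 0"
  shows "(scal p * Y + scal q * X + X * Y) * (scal p * Y + scal q * X + X * Y)
    = scal (p * q) * (X * Y + Y * X)"
proof -
  have "(scal p * Y) * (scal p * Y) = 0" "(scal q * X) * (scal q * X) = 0"
    "(scal p * Y) * (X * Y) = 0" "(scal q * X) * (X * Y) = 0" "(X * Y) * (scal p * Y) = 0"
    "(X * Y) * (scal q * X) = 0" "(X * Y) * (X * Y) = 0"
    using X Y XYX YXY by (metis mult.assoc scal_commute mult_zero_left mult_zero_right)+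
  moreover have "(scal p * Y) * (scal q * X) = scal (p * q) * (Y * X)"
    "(scal q * X) * (scal p * Y) = scal (p * q) * (X * Y)"
    by (metis mult.assoc scal_commute scal_mult mult.commute)+
  ultimately show ?thesis by (simp add: distrib_left distrib_right add.commute)
qed

definition elem_mat3 :: "3 \<Rightarrow> 3 \<Rightarrow> cmat3" where
  "elem_mat3 i j = Abs_cmat3 (\<chi> k l. if k = i \<and> l = j then 1 else 0)"

lemma trace3_mult_elem_mat3: "trace3 (N * elem_mat3 j i) = entry N i j"
  using exhaust_3[of i] exhaust_3[of j]
  by (auto simp: trace3_def entry_mult elem_mat3_def entry_Abs_cmat3)

text \<open>With N1 of rank one, both N1 N2 Z N1 and N2 N1 Z N1 are multiples of N1, which forces
  N1 N2 to be a multiple k N1 of N1; then 0 = N1 N2 N2 = k^2 N1.\<close>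
lemma square_zero_anticommuting_product:
  fixes N1 N2 :: cmat3
  assumes N1: "N1 * N1 = 0" and N2: "N2 * N2 = 0" and anti: "N1 * N2 + N2 * N1 = 0"
  shows "N1 * N2 = 0"
proof (cases "N1 = 0")
  case False
  then obtain i j where ij: "entry N1 i j \<noteq> 0" by (auto simp: cmat3_eq_iff entry_zero)
  have "scal (trace3 (N1 * (N2 * Z))) * N1 = scal (trace3 (N1 * Z)) * (N1 * N2)" for Z
  proof -
    have swap: "N1 * N2 = - (N2 * N1)" "N2 * N1 = - (N1 * N2)"
      using anti by (simp_all add: eq_neg_iff_add_eq_0 add.commute)
    have "scal (trace3 (N1 * (N2 * Z))) * N1 = N1 * (N2 * Z) * N1"
      by (simp add: square_zero_sandwich[OF N1])
    also have "\<dots> = - (N2 * (N1 * Z * N1))"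
      by (simp add: mult.assoc[symmetric] swap(1))
    also have "\<dots> = scal (trace3 (N1 * Z)) * - (N2 * N1)"
      by (simp add: square_zero_sandwich[OF N1] mult_scal_mult)
    finally show ?thesis by (simp add: swap(2))
  qed
  from this[of "elem_mat3 j i"] have "scal (trace3 (N1 * (N2 * elem_mat3 j i))) * N1
      = scal (entry N1 i j) * (N1 * N2)" by (simp add: trace3_mult_elem_mat3)
  then have "scal (inverse (entry N1 i j)) * (scal (trace3 (N1 * (N2 * elem_mat3 j i))) * N1)
      = scal (inverse (entry N1 i j)) * (scal (entry N1 i j) * (N1 * N2))" by simp
  then have k: "N1 * N2 = scal k * N1"
    if "k = inverse (entry N1 i j) * trace3 (N1 * (N2 * elem_mat3 j i))" for k
    using ij that by (simp add: mult.assoc[symmetric] flip: scal_mult) (simp add: scal_one)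
  define k where "k = inverse (entry N1 i j) * trace3 (N1 * (N2 * elem_mat3 j i))"
  have "0 = N1 * (N2 * N2)" using N2 by simp
  also have "\<dots> = scal k * (scal k * N1)"
    by (simp only: mult.assoc[symmetric] k[OF k_def]) (simp only: mult.assoc k[OF k_def])
  also have "\<dots> = scal (k * k) * N1" by (simp only: mult.assoc scal_mult)
  finally have "k * k * entry N1 i j = 0" by (metis entry_scal_mult entry_zero)
  then show ?thesis using k[OF k_def] ij by (simp add: scal_zero)
qed simp


lemma trace3_unimodular_unipotent:
  assumes "unimodular_unipotent X"
  shows "\<exists>g. trace3 X = 3 * g \<and> cmod g = 1"
  using assms square_zero_trace(1)
  by (auto simp: unimodular_unipotent_def trace3_add trace3_scal)

text \<open>The trace of A^(k+1) B grows linearly in k unless tr(N1 N2) = 0, while it is bounded since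
  A^(k+1) B is unimodular unipotent as well.\<close>
lemma unimodular_unipotents_mixed_trace:
  assumes N1: "N1 * N1 = 0" and N2: "N2 * N2 = 0" and "cmod \<alpha> = 1" "cmod \<beta> = 1"
    and powers: "\<And>k. unimodular_unipotent ((scal \<alpha> + N1) ^ Suc k * (scal \<beta> + N2))"
  shows "trace3 (N1 * N2) = 0"
proof (rule zero_if_linearly_bounded)
  fix k
  obtain g where g: "3 * g = 3 * \<alpha> ^ Suc k * \<beta> + of_nat (Suc k) * \<alpha> ^ k * trace3 (N1 * N2)"
    "cmod g = 1"
    using trace3_unimodular_unipotent[OF powers[of k]] trace3_unipotent_power_mult[OF N1 N2]
    by metis
  have "of_nat (Suc k) * \<alpha> ^ k * trace3 (N1 * N2) = 3 * g - 3 * \<alpha> ^ Suc k * \<beta>"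
    using g(1) by (simp add: algebra_simps)
  moreover have "cmod (of_nat (Suc k) * \<alpha> ^ k * trace3 (N1 * N2))
      = real (Suc k) * cmod (trace3 (N1 * N2))"
    by (simp only: norm_mult norm_power norm_of_nat \<open>cmod \<alpha> = 1\<close> power_one mult_1_right)
  ultimately have "real (Suc k) * cmod (trace3 (N1 * N2)) = cmod (3 * g - 3 * \<alpha> ^ Suc k * \<beta>)"
    by simp
  also have "\<dots> \<le> 6"
    using norm_triangle_ineq4[of "3 * g" "3 * \<alpha> ^ Suc k * \<beta>"] g(2) assms(3,4)
    by (simp add: norm_mult norm_power)
  finally show "real (Suc k) * cmod (trace3 (N1 * N2)) \<le> 6" .
qed

theorem unimodular_unipotents_commute:
  assumes A: "unimodular_unipotent A" and B: "unimodular_unipotent B"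
    and powers: "\<And>k. unimodular_unipotent (A ^ Suc k * B)"
  shows "A * B = B * A"
proof -
  obtain \<alpha> N1 where A: "A = scal \<alpha> + N1" "N1 * N1 = 0" "cmod \<alpha> = 1"
    using A unfolding unimodular_unipotent_def by blast
  obtain \<beta> N2 where B: "B = scal \<beta> + N2" "N2 * N2 = 0" "cmod \<beta> = 1"
    using B unfolding unimodular_unipotent_def by blast
  have T: "trace3 (N1 * N2) = 0" "trace3 (N2 * N1) = 0"
    using unimodular_unipotents_mixed_trace[OF A(2) B(2) A(3) B(3)] powers trace3_commute
    unfolding A(1) B(1) by metis+
  have AB: "A * B = scal (\<alpha> * \<beta>) + (scal \<alpha> * N2 + scal \<beta> * N1 + N1 * N2)"
    and BA: "B * A = scal (\<alpha> * \<beta>) + (scal \<alpha> * N2 + scal \<beta> * N1 + N2 * N1)"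
    using scal_plus_mult[of \<alpha> 1 N1 \<beta> 1 N2] scal_plus_mult[of \<beta> 1 N2 \<alpha> 1 N1]
    unfolding A(1) B(1) by (simp_all add: scal_one add_ac mult.commute)
  obtain g M where "A * B = scal g + M" "M * M = 0"
    using powers[of 0] unfolding unimodular_unipotent_def by auto
  moreover have "g = \<alpha> * \<beta>"
    using arg_cong[OF \<open>A * B = scal g + M\<close>, of trace3] square_zero_trace(1)[OF \<open>M * M = 0\<close>]
      square_zero_trace(1)[OF A(2)] square_zero_trace(1)[OF B(2)] T(1)
    unfolding AB by (simp add: trace3_add trace3_scal trace3_scal_mult)
  ultimately have
    "(scal \<alpha> * N2 + scal \<beta> * N1 + N1 * N2) * (scal \<alpha> * N2 + scal \<beta> * N1 + N1 * N2) = 0"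
    unfolding AB by simp
  moreover have "N1 * N2 * N1 = 0" "N2 * N1 * N2 = 0"
    using square_zero_sandwich[OF A(2), of N2] square_zero_sandwich[OF B(2), of N1] T
    by (simp_all add: scal_zero)
  ultimately have scaled: "scal (\<alpha> * \<beta>) * (N1 * N2 + N2 * N1) = 0"
    using square_of_sum_square_zero[OF A(2) B(2)] by simp
  have "\<alpha> * \<beta> \<noteq> 0" using A(3) B(3) by auto
  then have "N1 * N2 + N2 * N1 = scal (inverse (\<alpha> * \<beta>) * (\<alpha> * \<beta>)) * (N1 * N2 + N2 * N1)"
    by (metis left_inverse scal_one mult_1)
  also have "\<dots> = scal (inverse (\<alpha> * \<beta>)) * (scal (\<alpha> * \<beta>) * (N1 * N2 + N2 * N1))"
    by (simp only: scal_mult mult.assoc)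
  also have "\<dots> = 0" by (simp only: scaled mult_zero_right)
  finally have anti: "N1 * N2 + N2 * N1 = 0" .
  then have "N1 * N2 = 0" "N2 * N1 = 0"
    using square_zero_anticommuting_product[OF A(2) B(2)] by auto
  then show ?thesis unfolding AB BA by simp
qed

lemma idempotent_eq_one_if_det_nonzero:
  assumes "E * E = E" "det3 E \<noteq> 0"
  shows "E = 1"
proof -
  have "det3 E * det3 E = det3 E" using det3_mult[of E E] assms(1) by simp
  then have "det3 E = 1" using assms(2) by simp
  obtain E' where "Rep_cmat3 E' ** Rep_cmat3 E = mat 1"
    using assms(2) invertible_det_nz invertible_left_inverse unfolding det3_def
    by (metis Rep_cmat3_cases UNIV_I)
  then have "E' * E = 1" by (metis Rep_cmat3_mult Rep_cmat3_inverse one_cmat3_def)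
  then show ?thesis by (metis assms(1) mult.assoc mult_1)
qed

text \<open>Inside the corner E M E of a proper idempotent E, an element of the commutant of a
  non-commuting pair is singular, so its quadratic relation has no constant term.\<close>
lemma commutant_in_proper_corner:
  assumes idem: "E * E = E" "E \<noteq> 1" and corner: "X * E = X" "X * X' = E"
    and commute: "X * C = C * X" "X * D = D * X" "C * D \<noteq> D * C"
  shows "\<exists>s. X = scal s * E"
proof -
  have "det3 E = 0" using idempotent_eq_one_if_det_nonzero idem by blast
  then have "det (Rep_cmat3 X) = 0" using det3_mult[of X E] corner(1) unfolding det3_def by simp
  then obtain v where v: "Rep_cmat3 X *v v = 0" "v \<noteq> 0"
    using invertible_det_nz invertible_left_inverse matrix_left_invertible_ker by metis
  obtain s t where st: "X * X = scal s * X + scal t"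
    using commutant_of_noncommuting_pair[OF commute] by blast
  have XXv: "Rep_cmat3 (X * X) *v v = 0"
    by (simp add: Rep_cmat3_mult matrix_vector_mul_assoc[symmetric] v(1))
  have "(Rep_cmat3 (scal s * X + scal t) *v v) $ i = s * (Rep_cmat3 X *v v) $ i + t * v $ i"
    for i using exhaust_3[of i]
    by (auto simp: matrix_vector_mult_3_nth entry_def[symmetric] entry_add entry_scal_mult
        entry_scal algebra_simps)
  then have "t * v $ i = 0" for i using XXv v(1) unfolding st by simp
  moreover obtain i where "v $ i \<noteq> 0" using v(2) by (auto simp: vec_eq_iff)
  ultimately have "t = 0" by auto
  have "X = X * (X * X')" using corner by simp
  also have "\<dots> = scal s * (X * X')" using st \<open>t = 0\<close> by (simp add: scal_zero mult.assoc[symmetric])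
  finally show ?thesis using corner(2) by blast
qed

lemma commutant_in_proper_corner_commutative:
  fixes X Y E :: cmat3
  assumes idem: "E * E = E" "E \<noteq> 1"
    and corner: "X * E = X" "X * X' = E" "Y * E = Y" "Y * Y' = E"
    and commute: "X * C = C * X" "X * D = D * X" "Y * C = C * Y" "Y * D = D * Y" "C * D \<noteq> D * C"
  shows "X * Y = Y * X"
proof -
  obtain s s' where X: "X = scal s * E" and Y: "Y = scal s' * E"
    using commutant_in_proper_corner[OF idem] corner commute by metis
  have "X * Y = scal (s * s') * (E * E)" "Y * X = scal (s' * s) * (E * E)"
    unfolding X Y by (metis mult.assoc mult_scal_mult scal_mult_scal_mult)+
  then show ?thesis by (simp add: mult.commute)
qed

lemma concat_replicate_singleton: "concat (replicate k [x]) = replicate k x"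
  by (induction k) auto

text \<open>A nonempty word cannot be sent to a matrix of finite order, so every letter and every
  word is sent to a unimodular unipotent matrix, and these commute.\<close>
theorem no_injective_hom_into_commutant:
  fixes f :: "'s list \<Rightarrow> cmat3" and x y :: 's
  assumes "d > 0" "x \<noteq> y"
    and hom: "\<And>u v. f (u @ v) = f u * f v" "f [] = 1" and "inj f"
    and integral: "\<And>u. \<exists>Y. (\<forall>i j. entry (f u) i j \<in> O_d d \<and> entry Y i j \<in> O_d d)
      \<and> det3 (f u) * det3 Y = 1"
    and commute: "\<And>u. f u * C = C * f u" "\<And>u. f u * D = D * f u" "C * D \<noteq> D * C"
  shows False
proof -
  have power: "f (concat (replicate k u)) = f u ^ k" for k u
    by (induction k) (simp_all add: hom)
  have unipotent: "unimodular_unipotent (f u)" if "u \<noteq> []" for u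
  proof -
    have "f u ^ k \<noteq> 1" if "k > 0" for k
    proof
      assume "f u ^ k = 1"
      then have "f (concat (replicate k u)) = f []" using power hom(2) by simp
      then have "length (concat (replicate k u)) = 0" using \<open>inj f\<close> by (simp add: inj_eq)
      with \<open>k > 0\<close> \<open>u \<noteq> []\<close> show False by (simp add: length_concat sum_list_replicate)
    qed
    moreover obtain Y where "\<forall>i j. entry (f u) i j \<in> O_d d \<and> entry Y i j \<in> O_d d"
      "det3 (f u) * det3 Y = 1" using integral by blast
    ultimately show ?thesis
      using torsion_or_unimodular_unipotent[OF \<open>d > 0\<close> _ _ _ commute] by blast
  qed
  have "f (replicate k x) = f [x] ^ k" for k
    using power[of k "[x]"] by (simp add: concat_replicate_singleton)
  then have "f [x] ^ Suc k * f [y] = f (replicate (Suc k) x @ [y])" for k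
    by (simp only: hom(1))
  then have "unimodular_unipotent (f [x] ^ Suc k * f [y])" for k
    using unipotent[of "replicate (Suc k) x @ [y]"] by simp
  then have "f [x] * f [y] = f [y] * f [x]"
    by (intro unimodular_unipotents_commute unipotent) simp_all
  then have "f [x, y] = f [y, x]" using hom(1)[of "[x]" "[y]"] hom(1)[of "[y]" "[x]"] by simp
  with \<open>inj f\<close> \<open>x \<noteq> y\<close> show False by (simp add: inj_eq)
qed

section \<open>Embeddings of products of free monoids and free groups\<close>

lemma fg_reduce_reduced: "fg_reduced w \<Longrightarrow> fg_reduce w = w"
proof (induction w)
  case (Cons l w)
  then have "fg_reduce w = w" by (cases w) auto
  with Cons.prems show ?case by (cases w) (simp_all add: fg_reduce_def)
qed (simp add: fg_reduce_def)

lemma fg_mult_Nil_left: "w \<in> fg_carrier \<Longrightarrow> fg_mult [] w = w"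
  and fg_mult_Nil_right: "w \<in> fg_carrier \<Longrightarrow> fg_mult w [] = w"
  by (simp_all add: fg_mult_def fg_carrier_def fg_reduce_reduced)

lemma fg_reduced_map_Pair: "fg_reduced (map (Pair s) u)"
proof (induction u)
  case (Cons x u)
  then show ?case by (cases u) auto
qed simp

definition fg_word :: "'s list \<Rightarrow> (bool \<times> 's) list" where
  "fg_word u = map (Pair True) u"

definition fg_inverse_word :: "'s list \<Rightarrow> (bool \<times> 's) list" where
  "fg_inverse_word u = map (Pair False) (rev u)"

lemma fg_inverse_word_in_fg_carrier: "fg_inverse_word u \<in> fg_carrier"
  by (simp add: fg_carrier_def fg_inverse_word_def fg_reduced_map_Pair)

lemma fg_mult_fg_word: "fg_mult (fg_word u) (fg_word v) = fg_word (u @ v)"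
  using fg_reduce_reduced[OF fg_reduced_map_Pair[of True "u @ v"]]
    by (simp add: fg_mult_def fg_word_def)

lemma fg_mult_fg_inverse_word: "fg_mult (fg_word u) (fg_inverse_word u) = []"
proof -
  have "foldr fg_push (fg_word u) (fg_inverse_word u) = []"
    by (induction u rule: rev_induct) (simp_all add: fg_word_def fg_inverse_word_def)
  moreover have "foldr fg_push (fg_inverse_word u) [] = fg_inverse_word u"
    using fg_reduce_reduced[OF fg_reduced_map_Pair[of False "rev u"]]
    by (simp add: fg_reduce_def fg_inverse_word_def)
  ultimately show ?thesis by (simp add: fg_mult_def fg_reduce_def)
qed

text \<open>Both sg and fg contain a copy of the free monoid, via id and fg_word; this is all that is
  used of the factors of the products below.\<close>
locale word_monoid =
  fixes M :: "'m set" and mul :: "'m \<Rightarrow> 'm \<Rightarrow> 'm" and one :: 'm and word :: "'s list \<Rightarrow> 'm"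
  assumes one_closed: "one \<in> M"
    and mul_one: "x \<in> M \<Longrightarrow> mul x one = x" and one_mul: "x \<in> M \<Longrightarrow> mul one x = x"
    and word_closed: "word u \<in> M" and mul_word: "mul (word u) (word v) = word (u @ v)"
    and inj_word: "inj word" and word_Nil: "word [] = one"

interpretation sg: word_monoid sg_carrier sg_mult "[]" id
  by unfold_locales (simp_all add: sg_carrier_def sg_mult_def)

interpretation fg: word_monoid fg_carrier fg_mult "[]" fg_word
proof
  show "inj fg_word" by (simp add: inj_on_def fg_word_def)
  show "fg_mult (fg_word u) (fg_word v) = fg_word (u @ v)" for u v by (rule fg_mult_fg_word)
qed (simp_all add: fg_carrier_def fg_mult_Nil_left fg_mult_Nil_right fg_word_def fg_reduced_map_Pair)

locale product_embedding =
  L: word_monoid M1 mul1 one1 word1 + R: word_monoid M2 mul2 one2 word2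
  for M1 :: "'a set" and mul1 one1 and word1 :: "'s list \<Rightarrow> 'a"
    and M2 :: "'b set" and mul2 one2 and word2 :: "'r list \<Rightarrow> 'b" +
  fixes T :: "'t set" and tmul :: "'t \<Rightarrow> 't \<Rightarrow> 't" and \<phi> :: "'a \<times> 'b \<Rightarrow> 't"
  assumes embedding: "is_embedding (M1 \<times> M2) (prod_mult mul1 mul2) T tmul \<phi>"
begin

lemma hom:
  "x \<in> M1 \<Longrightarrow> x' \<in> M1 \<Longrightarrow> y \<in> M2 \<Longrightarrow> y' \<in> M2 \<Longrightarrow>
    \<phi> (mul1 x x', mul2 y y') = tmul (\<phi> (x, y)) (\<phi> (x', y'))"
  using embedding unfolding is_embedding_def prod_mult_def by force

lemma image_in: "x \<in> M1 \<Longrightarrow> y \<in> M2 \<Longrightarrow> \<phi> (x, y) \<in> T"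
  using embedding unfolding is_embedding_def by blast

lemma eq_iff:
  "x \<in> M1 \<Longrightarrow> y \<in> M2 \<Longrightarrow> x' \<in> M1 \<Longrightarrow> y' \<in> M2 \<Longrightarrow> \<phi> (x, y) = \<phi> (x', y') \<longleftrightarrow> x = x' \<and> y = y'"
  using embedding unfolding is_embedding_def inj_on_def by blast

lemma factors_commute:
  assumes "x \<in> M1" "y \<in> M2"
  shows "tmul (\<phi> (x, one2)) (\<phi> (one1, y)) = tmul (\<phi> (one1, y)) (\<phi> (x, one2))"
  using hom[OF assms(1) L.one_closed R.one_closed assms(2)]
    hom[OF L.one_closed assms(1) assms(2) R.one_closed]
  by (simp add: assms L.mul_one L.one_mul R.mul_one R.one_mul)

lemma left_hom: "x \<in> M1 \<Longrightarrow> x' \<in> M1 \<Longrightarrow> \<phi> (mul1 x x', one2) = tmul (\<phi> (x, one2)) (\<phi> (x', one2))"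
  using hom R.one_closed R.one_mul by force

lemma right_hom: "y \<in> M2 \<Longrightarrow> y' \<in> M2 \<Longrightarrow> \<phi> (one1, mul2 y y') = tmul (\<phi> (one1, y)) (\<phi> (one1, y'))"
  using hom L.one_closed L.one_mul by force

lemma left_word_append: "\<phi> (word1 (u @ v), one2) = tmul (\<phi> (word1 u, one2)) (\<phi> (word1 v, one2))"
  using left_hom L.word_closed by (simp flip: L.mul_word)

lemma right_word_append: "\<phi> (one1, word2 (u @ v)) = tmul (\<phi> (one1, word2 u)) (\<phi> (one1, word2 v))"
  using right_hom R.word_closed by (simp flip: R.mul_word)

lemma left_word_eq_iff: "\<phi> (word1 u, one2) = \<phi> (word1 v, one2) \<longleftrightarrow> u = v"
  using eq_iff L.word_closed R.one_closed L.inj_word by (simp add: inj_eq)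

lemma right_word_eq_iff: "\<phi> (one1, word2 u) = \<phi> (one1, word2 v) \<longleftrightarrow> u = v"
  using eq_iff L.one_closed R.word_closed R.inj_word by (simp add: inj_eq)

lemma left_letters_noncommuting:
  assumes "x \<noteq> y"
  shows "tmul (\<phi> (word1 [x], one2)) (\<phi> (word1 [y], one2))
    \<noteq> tmul (\<phi> (word1 [y], one2)) (\<phi> (word1 [x], one2))"
proof
  assume "tmul (\<phi> (word1 [x], one2)) (\<phi> (word1 [y], one2))
    = tmul (\<phi> (word1 [y], one2)) (\<phi> (word1 [x], one2))"
  then have "\<phi> (word1 [x, y], one2) = \<phi> (word1 [y, x], one2)"
    using left_word_append[of "[x]" "[y]"] left_word_append[of "[y]" "[x]"] by simp
  with assms show False by (simp add: left_word_eq_iff)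
qed

lemma right_letters_noncommuting:
  assumes "x \<noteq> y"
  shows "tmul (\<phi> (one1, word2 [x])) (\<phi> (one1, word2 [y]))
    \<noteq> tmul (\<phi> (one1, word2 [y])) (\<phi> (one1, word2 [x]))"
proof
  assume "tmul (\<phi> (one1, word2 [x])) (\<phi> (one1, word2 [y]))
    = tmul (\<phi> (one1, word2 [y])) (\<phi> (one1, word2 [x]))"
  then have "\<phi> (one1, word2 [x, y]) = \<phi> (one1, word2 [y, x])"
    using right_word_append[of "[x]" "[y]"] right_word_append[of "[y]" "[x]"] by simp
  with assms show False by (simp add: right_word_eq_iff)
qed

end

lemma product_embeddingI:
  assumes "word_monoid M1 mul1 one1 word1" "word_monoid M2 mul2 one2 word2"
    "is_embedding (M1 \<times> M2) (prod_mult mul1 mul2) T tmul \<phi>"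
  shows "product_embedding M1 mul1 one1 word1 M2 mul2 one2 word2 T tmul \<phi>"
  using assms by (simp add: product_embedding_def product_embedding_axioms_def)


text \<open>X commutes with a non-commuting pair, so it is a scalar; as it has an inverse Y of the same
  kind in the unital subring E M E, its eigenvalue is a unit of O_d, hence a root of unity.\<close>
lemma scalar_root_of_unity_2x2:
  fixes A B X Y E :: "complex^2^2"
  assumes "d > 0" and AB: "A ** B \<noteq> B ** A"
    and commute: "X ** A = A ** X" "X ** B = B ** X" "Y ** A = A ** Y" "Y ** B = B ** Y"
    and unit: "X ** Y = E" "A ** E = A" "E ** E = E"
    and entries: "X \<in> int_mats d" "Y \<in> int_mats d"
  shows "\<exists>l k. X = mat l \<and> E = mat 1 \<and> k > 0 \<and> l ^ k = 1"
proof -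
  obtain l m where l: "X = mat l" and m: "Y = mat m"
    using commutant_of_noncommuting_pair_2 commute AB by metis
  then have E: "E = mat (l * m)" using unit(1) by (simp add: mat_mult_mat)
  then have "l * m \<noteq> 0" using unit(2) AB by auto
  moreover have "(E ** E) $ 1 $ 1 = E $ 1 $ 1" using unit(3) by simp
  then have "(l * m) * (l * m) = l * m" by (simp add: E mat_mult_nth mat_nth)
  ultimately have lm: "l * m = 1" by simp
  have "X $ 1 $ 1 \<in> O_d d" "Y $ 1 $ 1 \<in> O_d d" using entries by (simp_all add: int_mats_def)
  then have "l \<in> O_d d" "m \<in> O_d d" by (simp_all add: l m mat_nth)
  then obtain k where "k > 0" "l ^ k = 1" using O_d_unit_root_of_unity[OF \<open>d > 0\<close> _ _ lm] by blast
  with l E lm show ?thesis by auto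
qed

theorem no_embedding_times_free_group_2x2:
  fixes \<phi> :: "'a \<times> (bool \<times> 'r) list \<Rightarrow> complex^2^2" and word :: "'s list \<Rightarrow> 'a"
    and x y :: 's and z :: 'r
  assumes "d > 0" "x \<noteq> y" and M: "word_monoid M mul one word"
    and emb: "is_embedding (M \<times> fg_carrier) (prod_mult mul fg_mult) (int_mats d) (**) \<phi>"
  shows False
proof -
  interpret product_embedding M mul one word fg_carrier fg_mult "[]" fg_word "int_mats d" "(**)" \<phi>
    by (rule product_embeddingI[OF M fg.word_monoid_axioms emb])
  define A B where "A = \<phi> (word [x], [])" "B = \<phi> (word [y], [])"
  define X Y E where "X = \<phi> (one, fg_word [z])" "Y = \<phi> (one, fg_inverse_word [z])" "E = \<phi> (one, [])"
  have "A ** B \<noteq> B ** A"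
    using left_letters_noncommuting[OF \<open>x \<noteq> y\<close>] by (simp add: A_B_def)
  moreover have "X ** A = A ** X" "X ** B = B ** X" "Y ** A = A ** Y" "Y ** B = B ** Y"
    using factors_commute[OF L.word_closed fg.word_closed]
      factors_commute[OF L.word_closed fg_inverse_word_in_fg_carrier]
    by (simp_all add: A_B_def X_Y_E_def)
  moreover have "X ** Y = E"
    using right_hom[OF fg.word_closed[of "[z]"] fg_inverse_word_in_fg_carrier[of "[z]"]]
    by (simp add: X_Y_E_def fg_mult_fg_inverse_word)
  moreover have "A ** E = A"
    using left_hom[OF L.word_closed[of "[x]"] L.one_closed] L.mul_one[OF L.word_closed[of "[x]"]]
    by (simp add: A_B_def X_Y_E_def)
  moreover have "E ** E = E"
    using right_hom[OF fg.one_closed fg.one_closed]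
      by (simp add: X_Y_E_def fg.one_mul[OF fg.one_closed])
  moreover have "X \<in> int_mats d" "Y \<in> int_mats d"
    unfolding X_Y_E_def
      by (simp_all add: image_in L.one_closed fg.word_closed fg_inverse_word_in_fg_carrier)
  ultimately have "\<exists>l k. X = mat l \<and> E = mat 1 \<and> k > 0 \<and> l ^ k = 1"
    by (rule scalar_root_of_unity_2x2[OF \<open>d > 0\<close>])
  then obtain l k where l: "X = mat l" and E: "E = mat 1" and "k > 0" "l ^ k = 1" by blast
  have "\<phi> (one, fg_word (replicate n z)) = mat (l ^ n)" for n
  proof (induction n)
    case 0
    then show ?case using E by (simp add: X_Y_E_def fg.word_Nil)
  next
    case (Suc n)
    then show ?case
      using right_word_append[of "[z]" "replicate n z"] l[unfolded X_Y_E_def]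
      by (simp add: mat_mult_mat)
  qed
  from this[of k] this[of 0] have "\<phi> (one, fg_word (replicate k z)) = \<phi> (one, fg_word [])"
    using \<open>l ^ k = 1\<close> by simp
  with \<open>k > 0\<close> show False by (simp add: right_word_eq_iff)
qed

theorem no_embedding_times_free_monoid_SL2:
  fixes \<phi> :: "'a \<times> 'r list \<Rightarrow> complex^2^2" and word :: "'s list \<Rightarrow> 'a" and x y :: 's and z :: 'r
  assumes "x \<noteq> y" and M: "word_monoid M mul one word"
    and emb: "is_embedding (M \<times> sg_carrier) (prod_mult mul sg_mult) (SL_mats d) (**) \<phi>"
  shows False
proof -
  interpret product_embedding M mul one word sg_carrier sg_mult "[]" id "SL_mats d" "(**)" \<phi>
    by (rule product_embeddingI[OF M sg.word_monoid_axioms emb])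
  define A B where "A = \<phi> (word [x], [])" "B = \<phi> (word [y], [])"
  define X where "X = \<phi> (one, [z])"
  have AB: "A ** B \<noteq> B ** A"
    using left_letters_noncommuting[OF \<open>x \<noteq> y\<close>] by (simp add: A_B_def)
  have "X ** A = A ** X" "X ** B = B ** X"
    using factors_commute[OF L.word_closed sg.word_closed[of "[z]"]]
      by (simp_all add: A_B_def X_def)
  then obtain l where l: "X = mat l" using commutant_of_noncommuting_pair_2[OF _ _ AB] by metis
  have "det X = 1" using image_in[OF L.one_closed sg.word_closed[of "[z]"]]
    by (simp add: X_def SL_mats_def)
  then have l2: "l * l = 1" by (simp add: l det_2 mat_nth)
  have "X ** \<phi> (one, []) = X"
    using right_word_append[of "[z]" "[]"] by (simp add: X_def)
  moreover have "l \<noteq> 0" using l2 by auto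
  ultimately have "\<phi> (one, []) = mat 1" by (simp add: l mat_mult_eq_self_iff)
  moreover have "\<phi> (one, [z, z]) = X ** X" using right_word_append[of "[z]" "[z]"]
    by (simp add: X_def)
  ultimately have "\<phi> (one, id [z, z]) = \<phi> (one, id [])" by (simp add: l mat_mult_mat l2)
  then show False by (simp only: right_word_eq_iff) simp
qed

text \<open>Restricted to the first factor, an embedding with invertible unit element is an injective
  homomorphism of the free monoid into the commutant of the images of two letters of the
  second factor.\<close>
lemma no_embedding_times_free_monoid_3x3_unital:
  fixes \<phi> :: "'a \<times> 'r list \<Rightarrow> complex^3^3" and word :: "'s list \<Rightarrow> 'a"
    and x y :: 's and x' y' :: 'r
  assumes "d > 0" "x \<noteq> y" "x' \<noteq> y'" and M: "word_monoid M mul one word"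
    and emb: "is_embedding (M \<times> sg_carrier) (prod_mult mul sg_mult) T (**) \<phi>" "T \<subseteq> int_mats d"
    and unital: "\<phi> (one, []) = mat 1"
    and unit_det: "\<And>u. \<exists>Y\<in>int_mats d. det (\<phi> (word u, [])) * det (Y :: complex^3^3) = 1"
  shows False
proof -
  interpret product_embedding M mul one word sg_carrier sg_mult "[]" id T "(**)" \<phi>
    by (rule product_embeddingI[OF M sg.word_monoid_axioms emb(1)])
  define f where "f u = Abs_cmat3 (\<phi> (word u, []))" for u
  define C D where "C = Abs_cmat3 (\<phi> (one, [x']))" "D = Abs_cmat3 (\<phi> (one, [y']))"
  show False
  proof (rule no_injective_hom_into_commutant[OF \<open>d > 0\<close> \<open>x \<noteq> y\<close>])
    show "f (u @ v) = f u * f v" for u v by (simp add: f_def left_word_append Abs_cmat3_mult)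
    show "f [] = 1" by (simp add: f_def L.word_Nil unital one_cmat3_def)
    show "inj f" by (rule injI) (simp add: f_def Abs_cmat3_inject left_word_eq_iff)
    show "\<exists>Y. (\<forall>i j. entry (f u) i j \<in> O_d d \<and> entry Y i j \<in> O_d d) \<and> det3 (f u) * det3 Y = 1" for u
    proof -
      obtain Y :: "complex^3^3" where "Y \<in> int_mats d" "det (\<phi> (word u, [])) * det Y = 1"
        using unit_det[of u] by blast
      moreover have "\<phi> (word u, []) \<in> int_mats d" using image_in L.word_closed sg.one_closed emb(2)
        by blast
      ultimately show ?thesis
        by (intro exI[of _ "Abs_cmat3 Y"])
          (simp add: f_def int_mats_def entry_Abs_cmat3 det3_def Abs_cmat3_inverse)
    qed
    show "f u * C = C * f u" "f u * D = D * f u" for u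
      using factors_commute[OF L.word_closed sg.word_closed]
      by (simp_all add: f_def C_D_def Abs_cmat3_mult)
    show "C * D \<noteq> D * C"
      using right_letters_noncommuting[OF \<open>x' \<noteq> y'\<close>]
        by (simp add: C_D_def Abs_cmat3_mult Abs_cmat3_inject)
  qed
qed

theorem no_embedding_times_free_monoid_SL3:
  fixes \<phi> :: "'a \<times> 'r list \<Rightarrow> complex^3^3" and word :: "'s list \<Rightarrow> 'a"
    and x y :: 's and x' y' :: 'r
  assumes "d > 0" "x \<noteq> y" "x' \<noteq> y'" and M: "word_monoid M mul one word"
    and emb: "is_embedding (M \<times> sg_carrier) (prod_mult mul sg_mult) (SL_mats d) (**) \<phi>"
  shows False
proof -
  interpret product_embedding M mul one word sg_carrier sg_mult "[]" id "SL_mats d" "(**)" \<phi>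
    by (rule product_embeddingI[OF M sg.word_monoid_axioms emb])
  have det: "det (\<phi> (u, [])) = 1" if "u \<in> M" for u
    using image_in[OF that sg.one_closed] by (simp add: SL_mats_def)
  have "Abs_cmat3 (\<phi> (one, [])) = 1"
  proof (rule idempotent_eq_one_if_det_nonzero)
    show "Abs_cmat3 (\<phi> (one, [])) * Abs_cmat3 (\<phi> (one, [])) = Abs_cmat3 (\<phi> (one, []))"
      using left_hom[OF L.one_closed L.one_closed]
        by (simp add: Abs_cmat3_mult L.one_mul[OF L.one_closed])
    show "det3 (Abs_cmat3 (\<phi> (one, []))) \<noteq> 0"
      using det[OF L.one_closed] by (simp add: det3_def Abs_cmat3_inverse)
  qed
  then have "\<phi> (one, []) = mat 1" by (simp add: one_cmat3_def Abs_cmat3_inject)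
  moreover have "mat 1 \<in> int_mats d" using zero_in_O_d one_in_O_d
    by (simp add: int_mats_def mat_nth)
  moreover have "SL_mats d \<subseteq> int_mats d" by (auto simp: SL_mats_def)
  ultimately show False
    using no_embedding_times_free_monoid_3x3_unital[OF assms(1-3) M emb] det[OF L.word_closed]
    by (metis det_I mult_1)
qed

text \<open>If E, the image of the unit, is not the identity, the images of the free group live in
  the corner E M E, where the commutant consists of multiples of E.\<close>
theorem no_embedding_free_group_times_free_monoid_3x3:
  fixes \<phi> :: "(bool \<times> 's) list \<times> 'r list \<Rightarrow> complex^3^3" and x y :: 's and x' y' :: 'r
  assumes "d > 0" "x \<noteq> y" "x' \<noteq> y'"
    and emb: "is_embedding (fg_carrier \<times> sg_carrier) (prod_mult fg_mult sg_mult) (int_mats d) (**) \<phi>"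
  shows False
proof -
  interpret product_embedding fg_carrier fg_mult "[]" fg_word sg_carrier sg_mult "[]" id
      "int_mats d" "(**)" \<phi>
    by (rule product_embeddingI[OF fg.word_monoid_axioms sg.word_monoid_axioms emb])
  define f f' where "f u = Abs_cmat3 (\<phi> (fg_word u, []))"
    "f' u = Abs_cmat3 (\<phi> (fg_inverse_word u, []))" for u
  define E where "E = Abs_cmat3 (\<phi> ([], []))"
  define C D where "C = Abs_cmat3 (\<phi> ([], [x']))" "D = Abs_cmat3 (\<phi> ([], [y']))"
  have inverse: "f u * f' u = E" for u
    using left_hom[OF fg.word_closed[of u] fg_inverse_word_in_fg_carrier[of u]]
    by (simp add: f_f'_def E_def Abs_cmat3_mult fg_mult_fg_inverse_word)
  have unit: "f u * E = f u" "E * E = E" for u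
    using left_hom[OF fg.word_closed[of u] fg.one_closed] left_hom[OF fg.one_closed fg.one_closed]
    by (simp_all add: f_f'_def E_def Abs_cmat3_mult fg.mul_one fg.one_closed fg.word_closed)
  have commute: "f u * C = C * f u" "f u * D = D * f u" for u
    using factors_commute[OF fg.word_closed sg.word_closed]
      by (simp_all add: f_f'_def C_D_def Abs_cmat3_mult)
  have CD: "C * D \<noteq> D * C"
    using right_letters_noncommuting[OF \<open>x' \<noteq> y'\<close>]
      by (simp add: C_D_def Abs_cmat3_mult Abs_cmat3_inject)
  show False
  proof (cases "E = 1")
    case True
    then have "\<phi> ([], []) = mat 1" by (simp add: E_def one_cmat3_def Abs_cmat3_inject)
    moreover have "\<exists>Y\<in>int_mats d. det (\<phi> (fg_word u, [])) * det (Y :: complex^3^3) = 1" for u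
    proof
      have "\<phi> (fg_word u, []) ** \<phi> (fg_inverse_word u, []) = mat 1"
        using inverse[of u] True
          by (simp add: f_f'_def E_def Abs_cmat3_mult one_cmat3_def Abs_cmat3_inject)
      from arg_cong[OF this, of det]
      show "det (\<phi> (fg_word u, [])) * det (\<phi> (fg_inverse_word u, [])) = 1"
        by (simp add: det_mul det_I)
      show "\<phi> (fg_inverse_word u, []) \<in> int_mats d"
        using image_in[OF fg_inverse_word_in_fg_carrier sg.one_closed] .
    qed
    ultimately show False
      using no_embedding_times_free_monoid_3x3_unital
          [OF assms(1-3) fg.word_monoid_axioms emb subset_refl]
      by blast
  next
    case False
    then have "f [x] * f [y] = f [y] * f [x]"
      using commutant_in_proper_corner_commutative[OF unit(2) False] unit(1) inverse commute CD
      by blast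
    then show False
      using left_letters_noncommuting[OF \<open>x \<noteq> y\<close>]
        by (simp add: f_f'_def Abs_cmat3_mult Abs_cmat3_inject)
  qed
qed

theorem proposition6:
  fixes d :: nat
  assumes "d \<in> {1, 2, 3, 7, 11}"
  shows
   "(\<not> (\<exists>\<phi> :: sig2 list \<times> (bool \<times> sig1) list \<Rightarrow> complex^2^2.
        is_embedding (sg_carrier \<times> fg_carrier) (prod_mult sg_mult fg_mult)
                     (int_mats d) (**) \<phi>))
  \<and> (\<not> (\<exists>\<phi> :: (bool \<times> sig2) list \<times> (bool \<times> sig1) list \<Rightarrow> complex^2^2.
        is_embedding (fg_carrier \<times> fg_carrier) (prod_mult fg_mult fg_mult)
                     (int_mats d) (**) \<phi>))
  \<and> (\<not> (\<exists>\<phi> :: (bool \<times> sig2) list \<times> sig1 list \<Rightarrow> complex^2^2.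
        is_embedding (fg_carrier \<times> sg_carrier) (prod_mult fg_mult sg_mult)
                     (SL_mats d) (**) \<phi>))
  \<and> (\<not> (\<exists>\<phi> :: sig2 list \<times> sig2 list \<Rightarrow> complex^3^3.
        is_embedding (sg_carrier \<times> sg_carrier) (prod_mult sg_mult sg_mult)
                     (SL_mats d) (**) \<phi>))
  \<and> (\<not> (\<exists>\<phi> :: (bool \<times> sig2) list \<times> sig2 list \<Rightarrow> complex^3^3.
        is_embedding (fg_carrier \<times> sg_carrier) (prod_mult fg_mult sg_mult)
                     (int_mats d) (**) \<phi>))"
proof -
  \<comment> \<open>only d > 0 is used: the argument works in every imaginary quadratic field\<close>
  have "d > 0" using assms by auto
  have "a \<noteq> b" by simp
  show ?thesis
  proof (intro conjI notI; elim exE)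
    show False if "is_embedding (sg_carrier \<times> fg_carrier)
        (prod_mult sg_mult fg_mult) (int_mats d) (**) \<phi>"
      for \<phi> :: "sig2 list \<times> (bool \<times> sig1) list \<Rightarrow> complex^2^2"
      using no_embedding_times_free_group_2x2[OF \<open>d > 0\<close> \<open>a \<noteq> b\<close> sg.word_monoid_axioms that] .
    show False if "is_embedding (fg_carrier \<times> fg_carrier)
        (prod_mult fg_mult fg_mult) (int_mats d) (**) \<phi>"
      for \<phi> :: "(bool \<times> sig2) list \<times> (bool \<times> sig1) list \<Rightarrow> complex^2^2"
      using no_embedding_times_free_group_2x2[OF \<open>d > 0\<close> \<open>a \<noteq> b\<close> fg.word_monoid_axioms that] .
    show False if "is_embedding (fg_carrier \<times> sg_carrier)
        (prod_mult fg_mult sg_mult) (SL_mats d) (**) \<phi>"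
      for \<phi> :: "(bool \<times> sig2) list \<times> sig1 list \<Rightarrow> complex^2^2"
      using no_embedding_times_free_monoid_SL2[OF \<open>a \<noteq> b\<close> fg.word_monoid_axioms that] .
    show False if "is_embedding (sg_carrier \<times> sg_carrier)
        (prod_mult sg_mult sg_mult) (SL_mats d) (**) \<phi>"
      for \<phi> :: "sig2 list \<times> sig2 list \<Rightarrow> complex^3^3"
      using no_embedding_times_free_monoid_SL3[OF \<open>d > 0\<close> \<open>a \<noteq> b\<close> \<open>a \<noteq> b\<close>
          sg.word_monoid_axioms that] .
    show False if "is_embedding (fg_carrier \<times> sg_carrier)
        (prod_mult fg_mult sg_mult) (int_mats d) (**) \<phi>"
      for \<phi> :: "(bool \<times> sig2) list \<times> sig2 list \<Rightarrow> complex^3^3"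
      using no_embedding_free_group_times_free_monoid_3x3[OF \<open>d > 0\<close> \<open>a \<noteq> b\<close> \<open>a \<noteq> b\<close> that] .
  qed
qed

end
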